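(* Assume the learning-rate assumption and the smoothness assumption stated in the context. Let $\bar\rho$ be a stationary solution of $\partial_t\rho_t=2\zeta(t)\nabla_\omega\cdot\big(\rho_t\nabla_\omega\Phi(\omega;\rho_t)\big)$. Suppose that for some neighborhood $\mathcal U$ of $\bar\rho$, constants $c_{\mathrm{KL}}>0$, $\theta\in[1/2,1)$, and all $\rho\in\mathcal U$, $$\mathcal I(\rho)^{1/2}\ge c_{\mathrm{KL}}\big(\mathcal E(\rho)-\mathcal E(\bar\rho)\big)^\theta,\qquad \mathcal I(\rho)=\int\|\nabla_\omega\Phi(\omega;\rho)\|^2\,\rho(d\omega).$$ Let $\rho_t$ be a solution of the PDE and assume that $\rho_t\in\mathcal U$ for $t\ge t_0$. Let $G(t)=\mathcal E(\rho_t)-\mathcal E(\bar\rho)$. Then, for $t\ge t_0$: 1. If $\theta=1/2$, then $$G(t)\le G(t_0)\exp\Big(-2c_{\mathrm{KL}}^2\int_{t_0}^t\zeta(r)\,dr\Big).$$ 2. If $1/2<\theta<1$, then $$G(t)\le\Big[G(t_0)^{1-2\theta}+2c_{\mathrm{KL}}^2(2\theta-1)\int_{t_0}^t\zeta(r)\,dr\Big]^{-1/(2\theta-1)}.$$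
   Context: Model. Fix positive integers $L,d_x,d_k,d_v$ and a fixed matrix $W_{\mathrm{out}}\in\mathbb R^{d_x\times d_v}$. A head parameter is $\omega=(W_Q,W_K,W_V,W_O)\in\mathbb R^{d_x\times d_k}\times\mathbb R^{d_x\times d_k}\times\mathbb R^{d_x\times d_k}\times\mathbb R^{d_k\times d_x}$, identified with a vector in $\mathbb R^{d_\omega}$. For an input $X\in\mathbb R^{L\times d_x}$ (rows are tokens), the causally masked attention matrix $A_\omega(X)\in\mathbb R^{L\times L}$ has entries $$A_\omega(X)_{rs}=\frac{\exp\big((XW_QW_K^\top X^\top)_{rs}/\sqrt{d_k}\big)}{\sum_{s'\le r}\exp\big((XW_QW_K^\top X^\top)_{rs'}/\sqrt{d_k}\big)}\ (s\le r),\qquad A_\omega(X)_{rs}=0\ (s>r).$$ $\psi_l(X;\omega)\in\mathbb R^{d_v}$ is the $l$-th row of $A_\omega(X)XW_VW_OW_{\mathrm{out}}$, $l=1,\dots,L$. Data and risk. $X$ is a random input and $Y_l(X)\in\mathbb R^{d_v}$ is a one-hot label for each $l$; $\mathbb E_X$ is expectation over $X$. $\mathrm{softmax}_j(z)=e^{z_j}/\sum_m e^{z_m}$. For a probability measure $\rho$ on $\mathbb R^{d_\omega}$, $z_l^\rho(X)=\int\psi_l(X;\omega)\,\rho(d\omega)$. The cross-entropy loss is $\ell(y,z)=\log\big(\sum_{j=1}^{d_v}e^{z_j}\big)-y^\top z$, the risk is $\mathcal E(\rho)=\mathbb E_X\big[\frac1L\sum_{l=1}^L\ell(Y_l(X),z_l^\rho(X))\big]$,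 and its first variation is $$\Phi(\omega;\rho)=\mathbb E_X\Big[\frac1L\sum_{l=1}^L\big\langle\mathrm{softmax}(z_l^\rho(X))-Y_l(X),\psi_l(X;\omega)\big\rangle\Big].$$ Solutions. $\mathcal P(K)$ is the set of Borel probability measures on $K$. A (weak) solution of the PDE is a narrowly continuous curve $t\mapsto\rho_t\in\mathcal P(K)$ such that for every $f\in C^1(K)$, $\frac{d}{dt}\int f\,d\rho_t=-2\zeta(t)\int\langle\nabla f(\omega),\nabla_\omega\Phi(\omega;\rho_t)\rangle\,\rho_t(d\omega)$ in the sense of distributions in time. $\bar\rho\in\mathcal P(K)$ is a stationary solution if the constant curve $\rho_t\equiv\bar\rho$ is a weak solution. Learning-rate assumption. $\zeta:[0,\infty)\to[0,\infty)$ is bounded and Lipschitz, and $\int_0^\infty\zeta(t)\,dt=\infty$. Smoothness assumption. $K\subset\mathbb R^{d_\omega}$ and $K_x\subset\mathbb R^{d_x}$ are compact, all measures considered are supported in $K$, all input tokens lie in $K_x$ (so $X\in K_x^L$), the maps $\omega\mapsto\psi_l(X;\omega)$ are $C^3$ on $K$ for all $l$ and almost every $X$, and there is $B_\psi<\infty$ with $$\sup_{X\in K_x^L,\,1\le l\le L,\,\omega\in K}\big(\|\psi_l(X;\omega)\|+\|\nabla_\omega\psi_l(X;\omega)\|+\|\nabla^2_\omega\psi_l(X;\omega)\|+\|\nabla^3_\omega\psi_l(X;\omega)\|\big)\le B_\psi.$$ *)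

theory Defs
  imports "HOL-Probability.Probability"
begin

text \<open>
  The dimensions L, d_x, d_k, d_v are the cardinalities of the finite index types
  'l, 'x, 'k, 'v; token positions additionally carry a linear order (needed for the causal mask).
  The norm and inner product that the product type of head parameters inherits are the Euclidean
  (Frobenius) ones, i.e. those of the identification with vectors of length d_omega.
\<close>

type_synonym ('row, 'col) matrix = "((real, 'col) vec, 'row) vec"

type_synonym ('x, 'k) head =
  "('x, 'k) matrix \<times> ('x, 'k) matrix \<times> ('x, 'k) matrix \<times> ('k, 'x) matrix"

subsection \<open>The attention model\<close>

definition attention ::
    "('x::finite, 'k::finite) head \<Rightarrow> ('l, 'x) matrix \<Rightarrow> ('l::{finite,linorder}, 'l) matrix" where
  "attention \<omega> X = (case \<omega> of (WQ, WK, WV, WO) \<Rightarrow>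
     (let S = X ** WQ ** transpose WK ** transpose X;
          e = (\<lambda>r s. exp (S $ r $ s / sqrt (real CARD('k))))
      in \<chi> r s. if s \<le> r then e r s / (\<Sum>s'\<in>{..r}. e r s') else 0))"

definition psi ::
    "('x, 'v) matrix \<Rightarrow> 'l::{finite,linorder} \<Rightarrow> ('l, 'x) matrix \<Rightarrow> ('x::finite, 'k::finite) head
      \<Rightarrow> real ^ 'v::finite" where
  "psi Wout l X \<omega> = (case \<omega> of (WQ, WK, WV, WO) \<Rightarrow>
     (attention \<omega> X ** X ** WV ** WO ** Wout) $ l)"

subsection \<open>Data, risk and first variation\<close>

definition softmax :: "real ^ 'v::finite \<Rightarrow> real ^ 'v" where
  "softmax z = (\<chi> j. exp (z $ j) / (\<Sum>m\<in>UNIV. exp (z $ m)))"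

definition cross_entropy :: "real ^ 'v::finite \<Rightarrow> real ^ 'v \<Rightarrow> real" where
  "cross_entropy y z = ln (\<Sum>j\<in>UNIV. exp (z $ j)) - y \<bullet> z"

definition one_hot :: "real ^ 'v::finite \<Rightarrow> bool" where
  "one_hot y \<longleftrightarrow> (\<exists>j. y = axis j 1)"

text \<open>
  The random input enters only through its law D on the space of L by d_x matrices; since the
  labels are functions of the input, every expectation over X is an integral against D.
\<close>

definition data_model ::
    "('l::{finite,linorder}, 'x::finite) matrix measure
      \<Rightarrow> ('l \<Rightarrow> ('l, 'x) matrix \<Rightarrow> real ^ 'v::finite) \<Rightarrow> bool" where
  "data_model D Y \<longleftrightarrow> prob_space D \<and> sets D = sets borel \<and>
     (\<forall>l. Y l \<in> borel_measurable D) \<and> (AE X in D. \<forall>l. one_hot (Y l X))"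

definition mean_output ::
    "('x, 'v) matrix \<Rightarrow> ('x::finite, 'k::finite) head measure
      \<Rightarrow> 'l::{finite,linorder} \<Rightarrow> ('l, 'x) matrix \<Rightarrow> real ^ 'v::finite" where
  "mean_output Wout \<rho> l X = (\<integral>\<omega>. psi Wout l X \<omega> \<partial>\<rho>)"

definition risk ::
    "('x, 'v) matrix \<Rightarrow> ('l, 'x) matrix measure
      \<Rightarrow> ('l::{finite,linorder} \<Rightarrow> ('l, 'x) matrix \<Rightarrow> real ^ 'v::finite)
      \<Rightarrow> ('x::finite, 'k::finite) head measure \<Rightarrow> real" where
  "risk Wout D Y \<rho> =
     (\<integral>X. (1 / real CARD('l)) *
        (\<Sum>l\<in>UNIV. cross_entropy (Y l X) (mean_output Wout \<rho> l X)) \<partial>D)"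

definition Phi ::
    "('x, 'v) matrix \<Rightarrow> ('l, 'x) matrix measure
      \<Rightarrow> ('l::{finite,linorder} \<Rightarrow> ('l, 'x) matrix \<Rightarrow> real ^ 'v::finite)
      \<Rightarrow> ('x::finite, 'k::finite) head measure \<Rightarrow> ('x, 'k) head \<Rightarrow> real" where
  "Phi Wout D Y \<rho> \<omega> =
     (\<integral>X. (1 / real CARD('l)) *
        (\<Sum>l\<in>UNIV. (softmax (mean_output Wout \<rho> l X) - Y l X) \<bullet> psi Wout l X \<omega>) \<partial>D)"

definition grad :: "('a::real_inner \<Rightarrow> real) \<Rightarrow> 'a \<Rightarrow> 'a" where
  "grad f x = (THE g. GDERIV f x :> g)"

definition dissipation ::
    "('x, 'v) matrix \<Rightarrow> ('l, 'x) matrix measure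
      \<Rightarrow> ('l::{finite,linorder} \<Rightarrow> ('l, 'x) matrix \<Rightarrow> real ^ 'v::finite)
      \<Rightarrow> ('x::finite, 'k::finite) head measure \<Rightarrow> real" where
  "dissipation Wout D Y \<rho> = (\<integral>\<omega>. (norm (grad (Phi Wout D Y \<rho>) \<omega>))\<^sup>2 \<partial>\<rho>)"

subsection \<open>Probability measures on K and the narrow topology\<close>

text \<open>
  Elements of P(K) live on the Borel sigma-algebra of the subspace K, so that integrals against
  them are integrals over K and functions need only be defined (and measurable) on K.
\<close>

definition prob_measures :: "'a::topological_space set \<Rightarrow> 'a measure set" where
  "prob_measures K = {\<rho>. prob_space \<rho> \<and> sets \<rho> = sets (restrict_space borel K)}"

text \<open>
  Coarsest topology making integration of every continuous function on K continuous; all uses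
  have K compact, where continuous functions on K are automatically bounded.
\<close>

definition narrow_topology :: "'a::topological_space set \<Rightarrow> 'a measure topology" where
  "narrow_topology K = topology_generated_by
     {{\<rho> \<in> prob_measures K. (\<integral>\<omega>. f \<omega> \<partial>\<rho>) \<in> V} | (f :: 'a \<Rightarrow> real) V.
        continuous_on K f \<and> open V}"

subsection \<open>Weak solutions\<close>

text \<open>
  On a general compact K the gradient of a function is meaningful only through an extension, so
  functions of class \<open>C\<^sup>1\<close> (and \<open>C\<^sup>3\<close> below) on K are those that are so on an open
  neighbourhood of K.
\<close>

definition C1_on :: "'a::real_inner set \<Rightarrow> ('a \<Rightarrow> real) \<Rightarrow> bool" where
  "C1_on K f \<longleftrightarrow> (\<exists>U. open U \<and> K \<subseteq> U \<and>
     (\<forall>x\<in>U. GDERIV f x :> grad f x) \<and> continuous_on U (grad f))"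

text \<open>Smooth functions with compact support in the open half-line \<open>{0<..}\<close>.\<close>

definition time_test_function :: "(real \<Rightarrow> real) \<Rightarrow> bool" where
  "time_test_function \<phi> \<longleftrightarrow> (\<forall>n. ((deriv ^^ n) \<phi>) differentiable_on UNIV) \<and>
     (\<exists>a b. 0 < a \<and> (\<forall>t. t \<notin> {a..b} \<longrightarrow> \<phi> t = 0))"

definition weak_solution ::
    "('x, 'v) matrix \<Rightarrow> ('l, 'x) matrix measure
      \<Rightarrow> ('l::{finite,linorder} \<Rightarrow> ('l, 'x) matrix \<Rightarrow> real ^ 'v::finite)
      \<Rightarrow> (real \<Rightarrow> real) \<Rightarrow> ('x::finite, 'k::finite) head set
      \<Rightarrow> (real \<Rightarrow> ('x, 'k) head measure) \<Rightarrow> bool" where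
  "weak_solution Wout D Y \<zeta> K \<rho> \<longleftrightarrow>
     continuous_map (top_of_set {0..}) (narrow_topology K) \<rho> \<and>
     (\<forall>f \<phi>. C1_on K f \<longrightarrow> time_test_function \<phi> \<longrightarrow>
        - (LBINT t:{0..}. deriv \<phi> t * (\<integral>\<omega>. f \<omega> \<partial>(\<rho> t))) =
        (LBINT t:{0..}. \<phi> t *
           (- 2 * \<zeta> t * (\<integral>\<omega>. grad f \<omega> \<bullet> grad (Phi Wout D Y (\<rho> t)) \<omega> \<partial>(\<rho> t)))))"

definition stationary_solution ::
    "('x, 'v) matrix \<Rightarrow> ('l, 'x) matrix measure
      \<Rightarrow> ('l::{finite,linorder} \<Rightarrow> ('l, 'x) matrix \<Rightarrow> real ^ 'v::finite)
      \<Rightarrow> (real \<Rightarrow> real) \<Rightarrow> ('x::finite, 'k::finite) head set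
      \<Rightarrow> ('x, 'k) head measure \<Rightarrow> bool" where
  "stationary_solution Wout D Y \<zeta> K \<rho> \<longleftrightarrow>
     \<rho> \<in> prob_measures K \<and> weak_solution Wout D Y \<zeta> K (\<lambda>t. \<rho>)"

subsection \<open>Standing assumptions\<close>

definition learning_rate :: "(real \<Rightarrow> real) \<Rightarrow> bool" where
  "learning_rate \<zeta> \<longleftrightarrow> (\<forall>t\<ge>0. 0 \<le> \<zeta> t) \<and> bounded (\<zeta> ` {0..}) \<and>
     (\<exists>C. C-lipschitz_on {0..} \<zeta>) \<and> (\<integral>\<^sup>+t\<in>{0..}. ennreal (\<zeta> t) \<partial>lborel) = \<infinity>"

text \<open>
  Total derivative as a bounded linear map, so that it can be iterated; norms of the iterated
  derivatives are operator norms.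
\<close>

definition Deriv ::
    "('a::real_normed_vector \<Rightarrow> 'b::real_normed_vector) \<Rightarrow> 'a \<Rightarrow> ('a \<Rightarrow>\<^sub>L 'b)" where
  "Deriv f x = Blinfun (frechet_derivative f (at x))"

definition C3_on ::
    "'a::real_normed_vector set \<Rightarrow> ('a \<Rightarrow> 'b::real_normed_vector) \<Rightarrow> bool" where
  "C3_on K f \<longleftrightarrow> (\<exists>U. open U \<and> K \<subseteq> U \<and>
     (\<forall>x\<in>U. f differentiable (at x) \<and> Deriv f differentiable (at x) \<and>
             Deriv (Deriv f) differentiable (at x)) \<and>
     continuous_on U (Deriv (Deriv (Deriv f))))"

definition smoothness_assumption ::
    "('x, 'v::finite) matrix \<Rightarrow> ('l::{finite,linorder}, 'x) matrix measure
      \<Rightarrow> ('x::finite, 'k::finite) head set \<Rightarrow> (real ^ 'x) set \<Rightarrow> bool" where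
  "smoothness_assumption Wout D K Kx \<longleftrightarrow> compact K \<and> compact Kx \<and>
     (AE X in D. \<forall>l. X $ l \<in> Kx) \<and>
     (AE X in D. \<forall>l. C3_on K (psi Wout l X)) \<and>
     (\<exists>B. \<forall>(X :: ('l, 'x) matrix) l. \<forall>\<omega>\<in>K. (\<forall>i. X $ i \<in> Kx) \<longrightarrow>
        norm (psi Wout l X \<omega>) + norm (Deriv (psi Wout l X) \<omega>) +
        norm (Deriv (Deriv (psi Wout l X)) \<omega>) +
        norm (Deriv (Deriv (Deriv (psi Wout l X))) \<omega>) \<le> B)"

end

theory Submission
  imports Defs
begin

text \<open>
  Along a weak solution every coordinate of the mean output, tested against the smooth function
  \<open>\<omega> \<mapsto> psi Wout l X \<omega>\<close>, has a weak time derivative with a continuous representative: the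
  gradient of the first variation depends continuously on time, uniformly on \<open>K\<close>. By the
  du Bois-Reymond lemma the mean output is then classically differentiable in time. The chain rule
  for the cross entropy, differentiation under the expectation and Fubini give the energy identity
  \<open>d/dt risk (\<rho> t) = - 2 * \<zeta> t * dissipation (\<rho> t)\<close>, and the Lojasiewicz inequality turns it into
  a differential inequality for the excess risk \<open>G\<close>: as long as \<open>G > 0\<close>, the quantity
  \<open>G * exp (2 * c\<^sup>2 * \<integral>\<zeta>)\<close>, respectively \<open>2 * c\<^sup>2 * (2 * \<theta> - 1) * \<integral>\<zeta> - G powr (1 - 2 * \<theta>)\<close>,
  is nonincreasing.
\<close>

text \<open>The obstacle is that the equation is known only in distributional form, for one
  time-independent test function at a time, while the risk is nonlinear in the measure. The risk
  sees the measure, however, only through the numbers \<open>\<integral>\<omega>. logit i (X,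
  \<omega>) \<partial>\<rho> t\<close>, which are linear in it, so for each fixed input each of them
  falls under the weak equation. Once they are classically differentiable, the nonlinear part is
  calculus in one real variable. Treating \<open>psi\<close> as a function of the pair
  \<open>(X, \<omega>)\<close> serves three ends: joint continuity gives measurability in
  \<open>X\<close>, compactness gives dominating constants that depend neither on the input nor on
  time, and derivatives exist in the whole ambient space, so that \<open>grad\<close> is meaningful
  also at boundary points of \<open>K\<close>. The excess risk may change sign, since
  \<open>\<rho>bar\<close> is not assumed to be a minimiser. Monotonicity carries positivity at time
  \<open>t\<close> back to all of \<open>{t0..t}\<close>; a nonpositive \<open>G t\<close> is
  bounded without the Lojasiewicz inequality.\<close>

section \<open>The du Bois-Reymond lemma on the half-line\<close>

text \<open>\<open>flat_exp 0\<close> is the classical flat function exp(-1/x). The powers of 1/x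
  are carried along because differentiation then stays inside the linear span of the family, and
  division by x raises the index by one.\<close>

definition flat_exp :: "nat \<Rightarrow> real \<Rightarrow> real" where
  "flat_exp n x = (if x > 0 then inverse x ^ n * exp (- inverse x) else 0)"

lemma flat_exp_tendsto_0: "((flat_exp n) \<longlongrightarrow> 0) (at_right 0)"
proof -
  have "((\<lambda>x::real. inverse x ^ n / exp (inverse x)) \<longlongrightarrow> 0) (at_right 0)"
    by (rule filterlim_compose[OF tendsto_power_div_exp_0 filterlim_inverse_at_top_right])
  moreover have "\<forall>\<^sub>F x in at_right 0. inverse x ^ n / exp (inverse x) = flat_exp n x"
    unfolding eventually_at_filter by (simp add: flat_exp_def exp_minus divide_inverse)
  ultimately show ?thesis
    using tendsto_cong by fast
qed

lemma diffquot_flat_exp: "(flat_exp n y - flat_exp n 0) / (y - 0) = flat_exp (Suc n) y"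
  by (simp add: flat_exp_def divide_inverse)

lemma flat_exp_tendsto_0': "(flat_exp n \<longlongrightarrow> 0) (at 0)"
proof (rule filterlim_split_at)
  have "\<forall>\<^sub>F y in at_left 0. flat_exp n y = 0"
    by (auto simp: flat_exp_def eventually_at_filter)
  then show "(flat_exp n \<longlongrightarrow> 0) (at_left 0)"
    by (rule tendsto_eventually)
qed (rule flat_exp_tendsto_0)

text \<open>Away from 0 this is the product rule. At 0 the difference quotient of one member is the
  next member, so the derivative there is a limit already known to be 0.\<close>

lemma DERIV_flat_exp:
  "(flat_exp n has_real_derivative flat_exp (n + 2) x - real n * flat_exp (n + 1) x) (at x)"
proof -
  consider "x > 0" | "x < 0" | "x = 0" by linarith
  then show ?thesis
  proof cases
    case 1
    have "((\<lambda>x. inverse x ^ n * exp (- inverse x)) has_real_derivative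
        flat_exp (n + 2) x - real n * flat_exp (n + 1) x) (at x)"
      \<comment> \<open>The power rule yields the truncated exponent \<open>n - 1\<close>, hence the
        separate case \<open>n = 0\<close>.\<close>
      using 1 by (cases n)
        (auto intro!: derivative_eq_intros simp: flat_exp_def power2_eq_square algebra_simps,
          metis Suc_pred neq0_conv power_Suc)
    then show ?thesis
      by (rule has_field_derivative_transform_within_open[of _ _ _ "{0<..}"])
        (use 1 in \<open>simp_all add: flat_exp_def\<close>)
  next
    case 2
    have "((\<lambda>x. 0) has_real_derivative flat_exp (n + 2) x - real n * flat_exp (n + 1) x) (at x)"
      using 2 by (simp add: flat_exp_def)
    then show ?thesis
      by (rule has_field_derivative_transform_within_open[of _ _ _ "{..<0}"])
        (use 2 in \<open>simp_all add: flat_exp_def\<close>)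
  next
    case 3
    then have "flat_exp (n + 2) x - real n * flat_exp (n + 1) x = 0"
      by (simp add: flat_exp_def)
    then show ?thesis
      unfolding has_field_derivative_iff 3 diffquot_flat_exp using flat_exp_tendsto_0' by simp
  qed
qed

text \<open>The generators are supported between \<open>a\<close> and \<open>b\<close>. Their span
  is closed under \<open>deriv\<close>, so the derivatives of every order demanded by
  \<open>time_test_function\<close> come from a single induction.\<close>

inductive_set bump_span :: "(real \<Rightarrow> real) set" where
  base: "(\<lambda>x. flat_exp n (x - a) * flat_exp m (b - x)) \<in> bump_span"
| add: "f \<in> bump_span \<Longrightarrow> g \<in> bump_span \<Longrightarrow> (\<lambda>x. f x + g x) \<in> bump_span"
| scale: "f \<in> bump_span \<Longrightarrow> (\<lambda>x. c * f x) \<in> bump_span"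

lemma bump_span_has_derivative:
  assumes "f \<in> bump_span"
  shows "\<exists>g\<in>bump_span. \<forall>x. (f has_real_derivative g x) (at x)"
  using assms
proof induction
  case (base n a m b)
  let ?F = "\<lambda>n m x. flat_exp n (x - a) * flat_exp m (b - x)"
  let ?g = "\<lambda>x. (?F (n+2) m x + (- real n) * ?F (n+1) m x) +
                  (- 1 * ?F n (m+2) x + real m * ?F n (m+1) x)"
  have "?g \<in> bump_span"
    by (intro bump_span.intros)
  moreover have "(?F n m has_real_derivative ?g x) (at x)" for x
    by (rule derivative_eq_intros DERIV_chain2[OF DERIV_flat_exp] refl
        | simp add: algebra_simps)+
  ultimately show ?case
    by (intro bexI[of _ ?g]) blast
next
  case (add f g)
  then obtain f' g' where "f' \<in> bump_span" "g' \<in> bump_span"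
    "\<And>x. (f has_real_derivative f' x) (at x)" "\<And>x. (g has_real_derivative g' x) (at x)"
    by blast
  then show ?case
    by (intro bexI[of _ "\<lambda>x. f' x + g' x"]) (auto intro: DERIV_add bump_span.add)
next
  case (scale f c)
  then obtain f' where "f' \<in> bump_span" "\<And>x. (f has_real_derivative f' x) (at x)"
    by blast
  then show ?case
    by (intro bexI[of _ "\<lambda>x. c * f' x"]) (auto intro: DERIV_cmult bump_span.scale)
qed

lemma bump_span_deriv: "f \<in> bump_span \<Longrightarrow> deriv f \<in> bump_span"
  using bump_span_has_derivative[of f] DERIV_imp_deriv[of f]
  by (metis (no_types, lifting) ext)

lemma bump_span_differentiable: "f \<in> bump_span \<Longrightarrow> f differentiable_on UNIV"
  using bump_span_has_derivative[of f]
  by (meson differentiable_on_def differentiable_at_withinI real_differentiable_def)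

lemma bump_span_smooth:
  "f \<in> bump_span \<Longrightarrow> ((deriv ^^ n) f) differentiable_on UNIV"
proof (induction n arbitrary: f)
  case (Suc n)
  then show ?case
    unfolding funpow_Suc_right o_apply by (simp add: bump_span_deriv)
qed (simp add: bump_span_differentiable)

text \<open>
  The antiderivative \<open>H\<close> of a bump is a smooth step; \<open>H (x - t) - H (x - s)\<close> is then a
  test function whose derivative is the difference of the bumps at \<open>t\<close> and \<open>s\<close>.
\<close>

lemma exists_test_function:
  fixes s t e :: real
  assumes "0 < e" "e < s" "e < t"
  shows "\<exists>\<eta> \<phi>. time_test_function \<phi> \<and> continuous_on UNIV \<eta> \<and>
     (\<forall>x. (\<phi> has_real_derivative \<eta> (x - t) - \<eta> (x - s)) (at x)) \<and>
     (\<forall>x. x \<notin> {min s t - e..max s t + e} \<longrightarrow> \<phi> x = 0) \<and>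
     (\<forall>x. \<eta> x \<ge> 0) \<and> (\<forall>x. \<eta> x \<noteq> 0 \<longrightarrow> \<bar>x\<bar> < e) \<and> \<eta> 0 > 0"
proof -
  define \<eta> where "\<eta> x = flat_exp 0 (x + e) * flat_exp 0 (e - x)" for x
  have \<eta>_in: "(\<lambda>x. \<eta> (x - t)) \<in> bump_span" for t
    using bump_span.base[of 0 "t - e" 0 "t + e"] by (simp add: \<eta>_def algebra_simps)
  have cont: "continuous_on UNIV \<eta>"
    using bump_span_differentiable[OF \<eta>_in[of 0]] differentiable_imp_continuous_on by auto
  have "\<exists>H. \<forall>x::real. -\<infinity> < ereal x \<longrightarrow> ereal x < \<infinity> \<longrightarrow> (H has_vector_derivative \<eta> x) (at x)"
    by (rule einterval_antiderivative)
      (use cont in \<open>auto simp: continuous_on_eq_continuous_at\<close>)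
  then obtain H where H: "\<And>x. (H has_real_derivative \<eta> x) (at x)"
    by (auto simp: has_real_derivative_iff_has_vector_derivative)
  have supp: "\<eta> x = 0" if "\<not> \<bar>x\<bar> < e" for x
    using that by (auto simp: \<eta>_def flat_exp_def)
  have H_const: "H x = H y" if "x \<in> S" "y \<in> S" "convex S" "\<And>z. z \<in> S \<Longrightarrow> \<not> \<bar>z\<bar> < e" for x y S
  proof -
    have "(H has_real_derivative 0) (at z within S)" if "z \<in> S" for z
      using H[of z] supp[of z] \<open>z \<in> S\<close> \<open>\<And>z. z \<in> S \<Longrightarrow> \<not> \<bar>z\<bar> < e\<close>
      by (metis has_field_derivative_at_within)
    then obtain c where "\<And>z. z \<in> S \<Longrightarrow> H z = c"
      using has_field_derivative_zero_constant[OF \<open>convex S\<close>] by meson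
    then show ?thesis
      using that by metis
  qed
  define \<phi> where "\<phi> x = H (x - t) - H (x - s)" for x
  have D\<phi>: "(\<phi> has_real_derivative \<eta> (x - t) - \<eta> (x - s)) (at x)" for x
    unfolding \<phi>_def
    by (rule derivative_eq_intros DERIV_chain2[OF H] refl | simp)+
  have vanish: "\<phi> x = 0" if "x \<notin> {min s t - e..max s t + e}" for x
  \<comment> \<open>Left of the interval both shifted arguments are at most \<open>- e\<close>,
    right of it both are at least \<open>e\<close>; \<open>H\<close> takes one value on each of
    these half-lines, so the difference cancels.\<close>
  proof (cases "x < min s t - e")
    case True
    then show ?thesis
      unfolding \<phi>_def using H_const[of "x - t" "{..- e}" "x - s"] by auto
  next
    case False
    then show ?thesis
      unfolding \<phi>_def using H_const[of "x - t" "{e..}" "x - s"] that by auto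
  qed
  have "deriv \<phi> = (\<lambda>x. \<eta> (x - t) + (- 1) * \<eta> (x - s))"
    using DERIV_imp_deriv[OF D\<phi>] by auto
  then have deriv_in: "deriv \<phi> \<in> bump_span"
    using bump_span.add[OF \<eta>_in bump_span.scale[OF \<eta>_in]] by metis
  \<comment> \<open>Only the derivative of \<open>\<phi>\<close> is shown to lie in the span, so
    order 0 is treated separately.\<close>
  have "((deriv ^^ n) \<phi>) differentiable_on UNIV" for n
  proof (cases n)
    case 0
    then show ?thesis
      using D\<phi> unfolding differentiable_on_def
      by (auto intro: differentiable_at_withinI real_differentiable_def[THEN iffD2])
  next
    case (Suc m)
    then show ?thesis
      using bump_span_smooth[OF deriv_in, of m] unfolding Suc funpow_Suc_right o_apply by simp
  qed
  then have "time_test_function \<phi>"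
    unfolding time_test_function_def using vanish assms
    by (intro conjI allI exI[of _ "min s t - e"] exI[of _ "max s t + e"]) auto
  moreover have "\<eta> x \<ge> 0" for x
    by (simp add: \<eta>_def flat_exp_def)
  moreover have "\<eta> 0 > 0"
    using assms by (simp add: \<eta>_def flat_exp_def)
  ultimately show ?thesis
    using cont D\<phi> vanish supp by (intro exI[of _ \<eta>] exI[of _ \<phi>]) blast
qed

section \<open>Continuous functions orthogonal to all derivatives of test functions\<close>

lemma set_lebesgue_integral_compact_support:
  fixes f :: "real \<Rightarrow> real"
  assumes "0 \<le> a" "continuous_on {a..b} f" "\<And>x. x \<notin> {a..b} \<Longrightarrow> f x = 0"
  shows "(LBINT x:{0..}. f x) = integral {a..b} f"
proof -
  have "(LBINT x:{0..}. f x) = (LBINT x:{a..b}. f x)"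
    unfolding set_lebesgue_integral_def
    by (rule Bochner_Integration.integral_cong)
      (use assms in \<open>auto simp: indicator_def\<close>)
  also have "\<dots> = integral {a..b} f"
    by (rule set_borel_integral_eq_integral) (rule borel_integrable_atLeastAtMost'[OF assms(2)])
  finally show ?thesis .
qed

text \<open>If \<open>w s < c < w t\<close>, take the test function whose derivative is a narrow
  bump at \<open>t\<close> minus one at \<open>s\<close>. This derivative integrates to zero against
  \<open>w\<close> by hypothesis and against the constant \<open>c\<close> by compact support, yet
  against \<open>w - c\<close> the integrand is nonnegative and positive at \<open>t\<close>. An
  inequality suffices because exchanging \<open>s\<close> and \<open>t\<close> gives
  equality.\<close>

lemma continuous_on_orthogonal_derivatives_const:
  fixes w :: "real \<Rightarrow> real"
  assumes w: "continuous_on {0..} w"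
    and orth: "\<And>\<phi> a b. time_test_function \<phi> \<Longrightarrow> 0 < a \<Longrightarrow> (\<And>x. x \<notin> {a..b} \<Longrightarrow> \<phi> x = 0) \<Longrightarrow>
       continuous_on UNIV (deriv \<phi>) \<Longrightarrow> integral {a..b} (\<lambda>x. deriv \<phi> x * w x) = 0"
    and "0 < s" "0 < t"
  shows "w t \<le> w s"
proof (rule ccontr)
  assume "\<not> w t \<le> w s"
  define c where "c = (w t + w s) / 2"
  have c: "w s < c" "c < w t"
    using \<open>\<not> w t \<le> w s\<close> by (auto simp: c_def)
  have isCont: "isCont w x" if "x > 0" for x
    using w that continuous_on_interior[of "{0..}" w x] by (simp add: interior_Ici[of "-1"])
  have "\<forall>\<^sub>F x in nhds t. c < w x" "\<forall>\<^sub>F x in nhds s. w x < c"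
    using order_tendstoD[OF isCont[unfolded isCont_def]] c \<open>0 < s\<close> \<open>0 < t\<close>
    by (auto simp: eventually_nhds_conv_at)
  then obtain d1 d2 where d: "d1 > 0" "d2 > 0" "\<And>x. dist x t < d1 \<Longrightarrow> c < w x"
      "\<And>x. dist x s < d2 \<Longrightarrow> w x < c"
    unfolding eventually_nhds_metric by blast
  define e where "e = min (min d1 d2) (min s t) / 2"
  have e: "0 < e" "e < s" "e < t" "e < d1" "e < d2"
    using d \<open>0 < s\<close> \<open>0 < t\<close> by (auto simp: e_def min_def)
  obtain \<eta> \<phi> where \<phi>: "time_test_function \<phi>" and \<eta>: "continuous_on UNIV \<eta>"
    and D: "\<And>x. (\<phi> has_real_derivative \<eta> (x - t) - \<eta> (x - s)) (at x)"
    and supp: "\<And>x. x \<notin> {min s t - e..max s t + e} \<Longrightarrow> \<phi> x = 0"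
    and \<eta>_props: "\<And>x. \<eta> x \<ge> 0" "\<And>x. \<eta> x \<noteq> 0 \<Longrightarrow> \<bar>x\<bar> < e" "\<eta> 0 > 0"
    using exists_test_function[OF e(1-3)] by metis
  \<comment> \<open>The interval is strictly larger than the support, so \<open>\<phi>\<close>
    vanishes at both ends; halving keeps the left end positive.\<close>
  define a b where "a = (min s t - e) / 2" and "b = max s t + e + 1"
  have ab: "0 < a" "a < b" "\<And>x. x \<notin> {a..b} \<Longrightarrow> \<phi> x = 0" "t \<in> {a..b}"
    using e supp by (auto simp: a_def b_def)
  have deriv: "deriv \<phi> = (\<lambda>x. \<eta> (x - t) - \<eta> (x - s))"
    using DERIV_imp_deriv[OF D] by auto
  have cont: "continuous_on UNIV (deriv \<phi>)"
    unfolding deriv by (intro continuous_intros continuous_on_compose2[OF \<eta>]) auto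
  have cont': "continuous_on {a..b} (deriv \<phi>)" "continuous_on {a..b} w"
    using cont w ab by (auto elim: continuous_on_subset)
  have "\<phi> b = 0" "\<phi> a = 0"
    using supp e by (auto simp: a_def b_def)
  have "(deriv \<phi> has_integral (\<phi> b - \<phi> a)) {a..b}"
    using ab D deriv
    by (intro fundamental_theorem_of_calculus)
      (auto simp: has_real_derivative_iff_has_vector_derivative has_vector_derivative_at_within)
  then have "((\<lambda>x. c * deriv \<phi> x) has_integral 0) {a..b}"
    using \<open>\<phi> a = 0\<close> \<open>\<phi> b = 0\<close> has_integral_mult_right[of "deriv \<phi>" 0 "{a..b}" c] by simp
  moreover have "((\<lambda>x. deriv \<phi> x * w x) has_integral 0) {a..b}"
    using orth[OF \<phi> ab(1,3) cont] cont'
      integrable_integral[of "\<lambda>x. deriv \<phi> x * w x" "{a..b}"]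
    by (simp add: integrable_continuous_interval continuous_on_mult)
  ultimately have "((\<lambda>x. deriv \<phi> x * w x - c * deriv \<phi> x) has_integral 0 - 0) {a..b}"
    by (rule has_integral_diff[rotated])
  then have int0: "integral {a..b} (\<lambda>x. deriv \<phi> x * (w x - c)) = 0"
    by (simp add: algebra_simps integral_unique)
  have pos: "deriv \<phi> x * (w x - c) \<ge> 0" for x
  proof -
    have "\<eta> (x - t) * (w x - c) \<ge> 0"
      using \<eta>_props(1,2)[of "x - t"] d(3)[of x] e by (cases "\<eta> (x - t) = 0") (auto simp: dist_real_def)
    moreover have "\<eta> (x - s) * (c - w x) \<ge> 0"
      using \<eta>_props(1,2)[of "x - s"] d(4)[of x] e by (cases "\<eta> (x - s) = 0") (auto simp: dist_real_def)
    ultimately show ?thesis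
      unfolding deriv by (simp add: algebra_simps)
  qed
  have "continuous_on {a..b} (\<lambda>x. deriv \<phi> x * (w x - c))"
    by (intro continuous_intros cont')
  then have "deriv \<phi> t * (w t - c) = 0"
    using int0 ab integral_eq_0_iff[of a b "\<lambda>x. deriv \<phi> x * (w x - c)"] pos by blast
  \<comment> \<open>If the bump at \<open>s\<close> reached \<open>t\<close>, then
    \<open>w t < c\<close> would follow; so only the positive bump contributes at
    \<open>t\<close>.\<close>
  moreover have "\<eta> (t - s) = 0"
    using \<eta>_props(2)[of "t - s"] d(4)[of t] e c by (fastforce simp: dist_real_def)
  ultimately show False
    using c \<eta>_props(3) by (simp add: deriv)
qed

text \<open>Subtract from \<open>z\<close> the primitive \<open>H\<close> of \<open>h\<close>.
  Integration by parts makes the difference orthogonal to all derivatives of test functions, hence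
  constant on the open half-line. Test functions vanish near 0, so the endpoint is reached by
  continuity, which also yields the one-sided derivative at 0.\<close>

lemma weak_derivative_imp_derivative:
  fixes z h :: "real \<Rightarrow> real"
  assumes z: "continuous_on {0..} z" and h: "continuous_on {0..} h"
    and weak: "\<And>\<phi>. time_test_function \<phi> \<Longrightarrow>
      - (LBINT t:{0..}. deriv \<phi> t * z t) = (LBINT t:{0..}. \<phi> t * h t)"
    and "0 \<le> t"
  shows "(z has_real_derivative h t) (at t within {0..})"
proof -
  define H where "H x = integral {0..x} h" for x
  have DH: "(H has_real_derivative h x) (at x within {0..})" if "0 \<le> x" for x
  proof -
    have "(H has_real_derivative h x) (at x within {0..x + 1})"
      unfolding H_def using that h
      by (intro integral_has_real_derivative) (auto elim: continuous_on_subset)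
    \<comment> \<open>The interval extends beyond \<open>x\<close>, so near \<open>x\<close> it
      agrees with the half-line.\<close>
    moreover have "at x within {0..x + 1} = at x within {0..}"
      by (rule at_within_nhd[of x "{..<x + 1}"]) auto
    ultimately show ?thesis by simp
  qed
  have H: "continuous_on {0..} H"
    using DH by (intro DERIV_continuous_on) auto
  define w where "w x = z x - H x" for x
  have w: "continuous_on {0..} w"
    unfolding w_def by (intro continuous_intros z H)
  have orth: "integral {a..b} (\<lambda>x. deriv \<phi> x * w x) = 0"
    if \<phi>: "time_test_function \<phi>" and "0 < a" and supp: "\<And>x. x \<notin> {a..b} \<Longrightarrow> \<phi> x = 0"
      and cont: "continuous_on UNIV (deriv \<phi>)" for \<phi> a b
  proof -
    have "\<phi> differentiable_on UNIV"
      using \<phi> unfolding time_test_function_def by (metis funpow_0)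
    then have D: "(\<phi> has_real_derivative deriv \<phi> x) (at x)" for x
      by (simp add: differentiable_on_def DERIV_deriv_iff_real_differentiable)
    then have cont\<phi>: "continuous_on UNIV \<phi>"
      by (auto intro!: DERIV_isCont simp: continuous_on_eq_continuous_at)
    have supp': "deriv \<phi> x = 0" if "x \<notin> {a..b}" for x
    proof -
      have "\<forall>\<^sub>F y in nhds x. y \<in> - {a..b}"
        using that by (intro eventually_nhds_in_open) auto
      then have "\<forall>\<^sub>F y in nhds x. \<phi> y = 0"
        by (rule eventually_mono) (use supp in auto)
      then show ?thesis
        using deriv_cong_ev[of \<phi> "\<lambda>_. 0" x x] by simp
    qed
    show ?thesis
    proof (cases "a \<le> b")
      case True
      have sub: "continuous_on {a..b} (deriv \<phi>)" "continuous_on {a..b} z" "continuous_on {a..b} h"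
        "continuous_on {a..b} H" "continuous_on {a..b} \<phi>"
        using cont cont\<phi> z h H \<open>0 < a\<close> by (auto elim: continuous_on_subset)
      have 1: "- integral {a..b} (\<lambda>x. deriv \<phi> x * z x) = integral {a..b} (\<lambda>x. \<phi> x * h x)"
        using weak[OF \<phi>] \<open>0 < a\<close> sub supp supp'
        by (subst (asm) (1 2) set_lebesgue_integral_compact_support[of a b])
          (auto intro!: continuous_intros)
      \<comment> \<open>Vanishing is given only outside the closed interval; its endpoints are
        limits of such points.\<close>
      have zero: "\<phi> b = 0" "\<phi> a = 0"
      proof -
        have van: "\<phi> x = 0" if "x \<in> closure (- {a..b})" for x
        proof -
          have "closure (- {a..b}) \<subseteq> {x. \<phi> x = 0}"
            using supp cont\<phi>
            by (intro closure_minimal) (auto intro!: closed_Collect_eq)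
          then show ?thesis using that by auto
        qed
        have "- {a..b} = {..<a} \<union> {b<..}" by auto
        then have "closure (- {a..b}) = {..a} \<union> {b..}" by (simp add: closure_Un)
        then show "\<phi> b = 0" "\<phi> a = 0" using van by auto
      qed
      have "((\<lambda>x. deriv \<phi> x * H x + \<phi> x * h x) has_integral \<phi> b * H b - \<phi> a * H a) {a..b}"
      proof (rule fundamental_theorem_of_calculus[OF True])
        fix x assume x: "x \<in> {a..b}"
        have "(H has_real_derivative h x) (at x within {a..b})"
          using DH[of x] x \<open>0 < a\<close> by (auto elim!: DERIV_subset)
        then have "((\<lambda>x. \<phi> x * H x) has_real_derivative deriv \<phi> x * H x + \<phi> x * h x) (at x within {a..b})"
          by (auto intro!: derivative_eq_intros has_field_derivative_at_within[OF D])
        then show "((\<lambda>x. \<phi> x * H x) has_vector_derivative deriv \<phi> x * H x + \<phi> x * h x) (at x within {a..b})"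
          by (simp add: has_real_derivative_iff_has_vector_derivative)
      qed
      then have "integral {a..b} (\<lambda>x. deriv \<phi> x * H x + \<phi> x * h x) = 0"
        using zero by (simp add: integral_unique)
      then have 2: "integral {a..b} (\<lambda>x. deriv \<phi> x * H x) + integral {a..b} (\<lambda>x. \<phi> x * h x) = 0"
        by (subst (asm) integral_add)
          (auto intro!: integrable_continuous_interval continuous_intros sub)
      show ?thesis
        unfolding w_def right_diff_distrib using 1 2
        by (subst integral_diff) (auto intro!: integrable_continuous_interval continuous_intros sub)
    qed auto
  qed
  have "w t \<le> w s" if "0 < s" "0 < t" for s t
    using orth by (intro continuous_on_orthogonal_derivatives_const[OF w _ that]) blast
  then have "w x = w 1" if "x > 0" for x
    using that by (meson order_antisym zero_less_one)
  then have w_pos: "\<And>x. x \<in> {0<..} \<Longrightarrow> w x = w 1"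
    by blast
  have w_closure: "w x = w 1" if "x \<in> closure {0<..}" for x
    by (rule continuous_constant_on_closure[OF _ w_pos that]) (simp add: w)
  have z_eq: "z x = w 1 + H x" if "x \<ge> 0" for x
  proof -
    have "w x = w 1"
      using w_closure[of x] that by simp
    then show ?thesis
      using w_def[of x] by linarith
  qed
  have "((\<lambda>x. w 1 + H x) has_real_derivative h t) (at t within {0..})"
    using DERIV_add[OF DERIV_const DH[OF \<open>0 \<le> t\<close>]] by simp
  then show ?thesis
    by (rule has_field_derivative_transform_within[of _ _ _ _ 1]) (use \<open>0 \<le> t\<close> z_eq in auto)
qed

section \<open>Continuously differentiable functions and differentiation under the integral\<close>

lemma grad_eqI:
  assumes "GDERIV f x :> g"
  shows "grad f x = g"
  unfolding grad_def
proof (rule the_equality)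
  show "GDERIV f x :> g" by (rule assms)
  fix g' assume "GDERIV f x :> g'"
  then have "(\<lambda>h. h \<bullet> g') = (\<lambda>h. h \<bullet> g)"
    using assms has_derivative_unique unfolding gderiv_def by blast
  then show "g' = g"
    by (metis vector_eq_ldot)
qed

text \<open>With \<open>K = UNIV\<close> the neighbourhood in \<open>C1_on\<close> can only be the
  whole space, so closure under arithmetic involves no intersection of neighbourhoods; the property
  then restricts to every \<open>K\<close>.\<close>

lemma C1_onI_UNIV:
  assumes "\<And>x. GDERIV f x :> g x" "continuous_on UNIV g"
  shows "C1_on UNIV f"
proof -
  have "grad f = g"
    using grad_eqI[OF assms(1)] by auto
  then show ?thesis
    unfolding C1_on_def using assms by auto
qed

lemma C1_on_UNIV_D:
  assumes "C1_on UNIV f"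
  shows "GDERIV f x :> grad f x" "continuous_on UNIV (grad f)"
  using assms unfolding C1_on_def by (auto simp: top.extremum_unique)

lemma C1_on_UNIV_subset: "C1_on UNIV f \<Longrightarrow> C1_on K f"
  unfolding C1_on_def by blast

lemma C1_on_UNIV_continuous: "C1_on UNIV f \<Longrightarrow> continuous_on S f"
  using C1_on_UNIV_D(1)[of f] unfolding gderiv_def
  by (meson continuous_at_imp_continuous_on has_derivative_continuous)

lemma C1_on_const: "C1_on UNIV (\<lambda>x. c)"
  by (rule C1_onI_UNIV[of _ "\<lambda>x. 0"]) (auto intro: GDERIV_const)

lemma C1_on_add:
  assumes "C1_on UNIV f" "C1_on UNIV g"
  shows "C1_on UNIV (\<lambda>x. f x + g x)"
  by (rule C1_onI_UNIV[OF GDERIV_add])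
    (use assms in \<open>auto intro!: C1_on_UNIV_D continuous_intros\<close>)

lemma C1_on_mult:
  assumes "C1_on UNIV f" "C1_on UNIV g"
  shows "C1_on UNIV (\<lambda>x. f x * g x)"
  by (rule C1_onI_UNIV[OF GDERIV_mult])
    (use assms in \<open>auto intro!: C1_on_UNIV_D C1_on_UNIV_continuous continuous_intros\<close>)

lemma C1_on_sum:
  assumes "\<And>i. i \<in> I \<Longrightarrow> C1_on UNIV (f i)"
  shows "C1_on UNIV (\<lambda>x. \<Sum>i\<in>I. f i x)"
  using assms
  by (induction I rule: infinite_finite_induct) (auto intro: C1_on_const C1_on_add)

lemma C1_on_exp:
  assumes "C1_on UNIV f"
  shows "C1_on UNIV (\<lambda>x. exp (f x))"
  by (rule C1_onI_UNIV[OF GDERIV_DERIV_compose[OF _ DERIV_exp]])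
    (use assms in \<open>auto intro!: C1_on_UNIV_D C1_on_UNIV_continuous continuous_intros\<close>)

lemma C1_on_inverse:
  assumes "C1_on UNIV f" "\<And>x. f x \<noteq> 0"
  shows "C1_on UNIV (\<lambda>x. inverse (f x))"
proof (rule C1_onI_UNIV)
  show "GDERIV (\<lambda>x. inverse (f x)) x :> - (inverse (f x))\<^sup>2 *\<^sub>R grad f x" for x
    using assms by (intro GDERIV_inverse C1_on_UNIV_D)
  show "continuous_on UNIV (\<lambda>x. - (inverse (f x))\<^sup>2 *\<^sub>R grad f x)"
    using assms by (intro continuous_intros C1_on_UNIV_D C1_on_UNIV_continuous) auto
qed

lemma C1_on_divide:
  assumes "C1_on UNIV f" "C1_on UNIV g" "\<And>x. g x \<noteq> 0"
  shows "C1_on UNIV (\<lambda>x. f x / g x)"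
  unfolding divide_inverse using assms by (intro C1_on_mult C1_on_inverse)

lemma C1_on_bounded_linear:
  fixes f :: "'a::euclidean_space \<Rightarrow> real"
  assumes "bounded_linear f"
  shows "C1_on UNIV f"
proof (rule C1_onI_UNIV)
  show "GDERIV f x :> adjoint f 1" for x
  proof -
    have "f = (\<lambda>h. h \<bullet> adjoint f 1)"
      using adjoint_works[of f _ 1] assms by (auto simp: bounded_linear.linear)
    then show ?thesis
      unfolding gderiv_def using bounded_linear_imp_has_derivative[OF assms] by metis
  qed
qed auto

text \<open>Reading the gradient in \<open>\<omega>\<close> as a component of the joint gradient
  lets it inherit continuity in \<open>(X, \<omega>)\<close>, on which measurability in
  \<open>X\<close> and bounds over compact products rest.\<close>

lemma GDERIV_snd:
  assumes "C1_on UNIV q"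
  shows "GDERIV (\<lambda>\<omega>. q (X, \<omega>)) \<omega> :> snd (grad q (X, \<omega>))"
proof -
  have "((\<lambda>\<omega>. (X, \<omega>)) has_derivative (\<lambda>h. (0, h))) (at \<omega>)"
    by (auto intro!: derivative_eq_intros)
  from has_derivative_compose[OF this C1_on_UNIV_D(1)[OF assms, unfolded gderiv_def]]
  show ?thesis
    unfolding gderiv_def by (simp add: inner_prod_def)
qed

lemma grad_snd:
  assumes "C1_on UNIV q"
  shows "grad (\<lambda>\<omega>. q (X, \<omega>)) = (\<lambda>\<omega>. snd (grad q (X, \<omega>)))"
  using grad_eqI[OF GDERIV_snd[OF assms]] by auto

lemma continuous_grad_snd:
  assumes "C1_on UNIV q"
  shows "continuous_on S (\<lambda>z. snd (grad q z))"
  by (intro continuous_intros continuous_on_subset[OF C1_on_UNIV_D(2)[OF assms]]) auto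

lemma C1_on_snd:
  assumes "C1_on UNIV q"
  shows "C1_on UNIV (\<lambda>\<omega>. q (X, \<omega>))"
  by (rule C1_onI_UNIV[OF GDERIV_snd[OF assms]])
    (rule continuous_on_compose2[OF continuous_grad_snd[OF assms, of UNIV]],
      auto intro!: continuous_intros)

text \<open>Every entry is built from polynomials in the matrix entries, exponentials of them, and
  quotients whose denominator is a sum of exponentials over the nonempty set \<open>{..r}\<close>,
  hence never zero.\<close>

lemma C1_on_psi:
  fixes Wout :: "('x::finite, 'v::finite) matrix" and l :: "'l::{finite,linorder}"
  shows "C1_on UNIV (\<lambda>z :: ('l, 'x) matrix \<times> ('x, 'k::finite) head.
    psi Wout l (fst z) (snd z) $ j)"
proof -
  let ?X = "\<lambda>i j (z :: ('l, 'x) matrix \<times> ('x, 'k) head). fst z $ i $ j"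
  let ?Q = "\<lambda>i j (z :: ('l, 'x) matrix \<times> ('x, 'k) head). fst (snd z) $ i $ j"
  let ?KK = "\<lambda>i j (z :: ('l, 'x) matrix \<times> ('x, 'k) head). fst (snd (snd z)) $ i $ j"
  let ?V = "\<lambda>i j (z :: ('l, 'x) matrix \<times> ('x, 'k) head). fst (snd (snd (snd z))) $ i $ j"
  let ?O = "\<lambda>i j (z :: ('l, 'x) matrix \<times> ('x, 'k) head). snd (snd (snd (snd z))) $ i $ j"
  note bl = bounded_linear_compose[OF bounded_linear_vec_nth bounded_linear_compose[OF bounded_linear_vec_nth]]
    bounded_linear_compose[OF bounded_linear_fst] bounded_linear_compose[OF bounded_linear_snd] bounded_linear_ident
  have X: "C1_on UNIV (?X i j)" for i j
    by (intro C1_on_bounded_linear bl)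
  have Q: "C1_on UNIV (?Q i j)" for i j
    by (intro C1_on_bounded_linear bl)
  have KK: "C1_on UNIV (?KK i j)" for i j
    by (intro C1_on_bounded_linear bl)
  have V: "C1_on UNIV (?V i j)" for i j
    by (intro C1_on_bounded_linear bl)
  have O: "C1_on UNIV (?O i j)" for i j
    by (intro C1_on_bounded_linear bl)
  define S where "S r s z = (fst z ** fst (snd z) ** transpose (fst (snd (snd z))) ** transpose (fst z)) $ r $ s"
    for r s and z :: "('l, 'x) matrix \<times> ('x, 'k) head"
  have S: "C1_on UNIV (S r s)" for r s
    unfolding S_def matrix_matrix_mult_def transpose_def
    by (simp add: sum_distrib_right) (intro C1_on_sum C1_on_mult X Q KK)
  define E where "E r s z = exp (S r s z / sqrt (real CARD('k)))" for r s z
  have E: "C1_on UNIV (E r s)" for r s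
    unfolding E_def divide_inverse by (intro C1_on_exp C1_on_mult S C1_on_const)
  have Z: "(\<Sum>s'\<in>{..r}. E r s' z) \<noteq> 0" for r z
    by (rule order.strict_implies_not_eq[symmetric], rule sum_pos) (auto simp: E_def)
  define A where "A r s z = attention (snd z) (fst z) $ r $ s"
    for r s and z :: "('l, 'x) matrix \<times> ('x, 'k) head"
  have A: "C1_on UNIV (A r s)" for r s
  proof -
    have "A r s = (\<lambda>z. if s \<le> r then E r s z / (\<Sum>s'\<in>{..r}. E r s' z) else 0)"
      by (auto simp: A_def attention_def E_def S_def Let_def split: prod.split)
    then show ?thesis
      by (cases "s \<le> r") (auto intro!: C1_on_divide C1_on_sum E Z C1_on_const)
  qed
  have "(\<lambda>z. psi Wout l (fst z) (snd z) $ j) =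
    (\<lambda>z. \<Sum>k\<in>UNIV. (\<Sum>k1\<in>UNIV. (\<Sum>k2\<in>UNIV. (\<Sum>k3\<in>UNIV. A l k3 z * ?X k3 k2 z) * ?V k2 k1 z) * ?O k1 k z) * Wout $ k $ j)"
    by (auto simp: psi_def A_def matrix_matrix_mult_def split: prod.split)
  then show ?thesis
    by (simp only:) (intro C1_on_sum C1_on_mult A X V O C1_on_const)
qed

text \<open>Dominated convergence for difference quotients. The set \<open>S\<close> is merely
  convex, as the mean value inequality requires; this admits both a ball of parameters and the
  half-line of times, where the derivative at 0 is one-sided.\<close>

lemma has_derivative_integral:
  fixes F :: "'a \<Rightarrow> 'w::euclidean_space \<Rightarrow> real" and g :: "'a \<Rightarrow> 'w \<Rightarrow> 'w"
  assumes "finite_measure M" and S: "convex S" "w0 \<in> S"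
    and int: "\<And>w. w \<in> S \<Longrightarrow> integrable M (\<lambda>x. F x w)"
    and meas: "(\<lambda>x. g x w0) \<in> borel_measurable M"
    and deriv: "AE x in M. \<forall>w\<in>S. (F x has_derivative (\<lambda>h. h \<bullet> g x w)) (at w within S) \<and> norm (g x w) \<le> B"
  shows "((\<lambda>w. \<integral>x. F x w \<partial>M) has_derivative (\<lambda>h. h \<bullet> (\<integral>x. g x w0 \<partial>M))) (at w0 within S)"
  unfolding has_derivative_within
proof
  interpret finite_measure M by fact
  show "bounded_linear (\<lambda>h. h \<bullet> (\<integral>x. g x w0 \<partial>M))"
    by (rule bounded_linear_inner_left)
  have int_g: "integrable M (\<lambda>x. g x w0)"
    by (rule integrable_const_bound[of _ B]) (use deriv S meas in auto)
  let ?R = "\<lambda>x w. (1 / norm (w - w0)) *\<^sub>R (F x w - (F x w0 + (w - w0) \<bullet> g x w0))"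
  have eq: "(1 / norm (w - w0)) *\<^sub>R ((\<integral>x. F x w \<partial>M) - ((\<integral>x. F x w0 \<partial>M) + (w - w0) \<bullet> (\<integral>x. g x w0 \<partial>M)))
      = (\<integral>x. ?R x w \<partial>M)" if "w \<in> S" for w
    using int[OF that] int[OF S(2)] int_g by simp
  show "((\<lambda>w. (1 / norm (w - w0)) *\<^sub>R ((\<integral>x. F x w \<partial>M) -
      ((\<integral>x. F x w0 \<partial>M) + (w - w0) \<bullet> (\<integral>x. g x w0 \<partial>M)))) \<longlongrightarrow> 0) (at w0 within S)"
    unfolding tendsto_at_iff_sequentially o_def
  proof (intro allI impI)
    fix W :: "nat \<Rightarrow> 'w" assume W: "\<forall>i. W i \<in> S - {w0}" "W \<longlonglongrightarrow> w0"
    have "(\<lambda>i. \<integral>x. ?R x (W i) \<partial>M) \<longlonglongrightarrow> (\<integral>x. 0 \<partial>M)"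
    \<comment> \<open>One \<open>B\<close> bounds the increment quotient, by the mean value
      inequality, the other the linear term.\<close>
    proof (rule integral_dominated_convergence[where w = "\<lambda>x. 2 * B"])
      show "(\<lambda>x. ?R x (W i)) \<in> borel_measurable M" for i
      proof -
        have [measurable]: "(\<lambda>x. F x (W i)) \<in> borel_measurable M" "(\<lambda>x. F x w0) \<in> borel_measurable M"
          using int W S by (auto dest: borel_measurable_integrable)
        note meas[measurable]
        show ?thesis by measurable
      qed
      show "AE x in M. (\<lambda>i. ?R x (W i)) \<longlonglongrightarrow> 0"
        using deriv
      proof eventually_elim
        case (elim x)
        then have "((\<lambda>w. ?R x w) \<longlongrightarrow> 0) (at w0 within S)"
          using S unfolding has_derivative_within by blast
        then show ?case
          using W unfolding tendsto_at_iff_sequentially o_def by blast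
      qed
      show "AE x in M. norm (?R x (W i)) \<le> 2 * B" for i
        using deriv
      proof eventually_elim
        case (elim x)
        have Wi: "W i \<in> S" "W i \<noteq> w0" using W by auto
        have "norm (F x (W i) - F x w0) \<le> B * norm (W i - w0)"
        proof (rule differentiable_bound[OF S(1)])
          show "onorm (\<lambda>h. h \<bullet> g x w) \<le> B" if "w \<in> S" for w
          proof (rule onorm_le)
            fix h
            have "norm (h \<bullet> g x w) \<le> norm h * norm (g x w)"
              using Cauchy_Schwarz_ineq2 by auto
            also have "\<dots> \<le> norm h * B"
              using elim that by (intro mult_left_mono) auto
            finally show "norm (h \<bullet> g x w) \<le> B * norm h" by (simp add: mult.commute)
          qed
        qed (use elim Wi S in auto)
        moreover have "norm ((W i - w0) \<bullet> g x w0) \<le> B * norm (W i - w0)"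
        proof -
          have "norm ((W i - w0) \<bullet> g x w0) \<le> norm (W i - w0) * norm (g x w0)"
            using Cauchy_Schwarz_ineq2 by auto
          also have "\<dots> \<le> norm (W i - w0) * B"
            using elim S by (intro mult_left_mono) auto
          finally show ?thesis by (simp add: mult.commute)
        qed
        ultimately have "\<bar>F x (W i) - (F x w0 + (W i - w0) \<bullet> g x w0)\<bar> \<le> 2 * B * norm (W i - w0)"
          unfolding real_norm_def by linarith
        then show ?case
          using Wi by (simp add: divide_le_eq)
      qed
    qed simp_all
    moreover have "(\<integral>x. ?R x (W i) \<partial>M) = (1 / norm (W i - w0)) *\<^sub>R ((\<integral>x. F x (W i) \<partial>M) -
      ((\<integral>x. F x w0 \<partial>M) + (W i - w0) \<bullet> (\<integral>x. g x w0 \<partial>M)))" for i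
      using W eq[of "W i"] by simp
    ultimately show "(\<lambda>i. (1 / norm (W i - w0)) *\<^sub>R ((\<integral>x. F x (W i) \<partial>M) -
      ((\<integral>x. F x w0 \<partial>M) + (W i - w0) \<bullet> (\<integral>x. g x w0 \<partial>M)))) \<longlonglongrightarrow> 0"
      by (simp only: integral_zero)
  qed
qed

section \<open>Decay from a Lojasiewicz inequality\<close>

lemma DERIV_within_nonpos_imp_le:
  fixes f :: "real \<Rightarrow> real"
  assumes "a \<le> b"
    and D: "\<And>x. x \<in> {a..b} \<Longrightarrow> (f has_real_derivative f' x) (at x within {a..b})"
    and np: "\<And>x. x \<in> {a..b} \<Longrightarrow> f' x \<le> 0"
  shows "f b \<le> f a"
proof (cases "a = b")
  case False
  then have "\<exists>x\<in>{a<..<b}. f b - f a = f' x * (b - a)"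
    using assms(1) D by (intro mvt_simple[of a b f "\<lambda>x h. f' x * h"]) (auto simp: has_field_derivative_def)
  then obtain x where "x \<in> {a<..<b}" "f b - f a = f' x * (b - a)" by blast
  then show ?thesis
    using np[of x] assms(1) mult_nonpos_nonneg[of "f' x" "b - a"] by auto
qed simp

text \<open>Squaring the inequality gives
  \<open>c\<^sup>2 * G x powr (2 * \<theta>) \<le> I x\<close>, which compares the derivative of
  \<open>G\<close> with a power of \<open>G\<close>. Plain monotonicity is exported as well: it
  settles \<open>G t0 = 0\<close>, where \<open>powr\<close> does not represent the intended
  negative power.\<close>

lemma KL_decay:
  fixes G I \<zeta> :: "real \<Rightarrow> real" and c \<theta> t0 :: real
  assumes \<zeta>: "continuous_on {t0..} \<zeta>" "\<And>t. t0 \<le> t \<Longrightarrow> 0 \<le> \<zeta> t"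
    and D: "\<And>t. t0 \<le> t \<Longrightarrow> (G has_real_derivative - 2 * \<zeta> t * I t) (at t within {t0..})"
    and I: "\<And>t. t0 \<le> t \<Longrightarrow> 0 \<le> I t"
    and KL: "\<And>t. t0 \<le> t \<Longrightarrow> 0 \<le> G t \<Longrightarrow> c * G t powr \<theta> \<le> sqrt (I t)"
    and "0 < c" "1 / 2 \<le> \<theta>" "\<theta> < 1" "t0 \<le> t"
  shows "\<theta> = 1 / 2 \<Longrightarrow> G t \<le> G t0 * exp (- 2 * c\<^sup>2 * integral {t0..t} \<zeta>)"
    and "1 / 2 < \<theta> \<Longrightarrow>
      G t \<le> (G t0 powr (1 - 2 * \<theta>) + 2 * c\<^sup>2 * (2 * \<theta> - 1) * integral {t0..t} \<zeta>)
               powr (- 1 / (2 * \<theta> - 1))"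
    and "G t \<le> G t0"
proof -
  define Z where "Z x = integral {t0..x} \<zeta>" for x
  have DG: "(G has_real_derivative - 2 * \<zeta> x * I x) (at x within {t0..s})" if "x \<in> {t0..s}" for x s
    using that by (intro DERIV_subset[OF D]) auto
  have DZ: "(Z has_real_derivative \<zeta> x) (at x within {t0..s})" if "x \<in> {t0..s}" for x s
    unfolding Z_def using that \<zeta>(1)
    by (intro integral_has_real_derivative) (auto elim: continuous_on_subset)
  have mono: "G y \<le> G x" if "t0 \<le> x" "x \<le> y" for x y
  proof (rule DERIV_within_nonpos_imp_le[OF \<open>x \<le> y\<close>])
    fix u assume "u \<in> {x..y}"
    show "(G has_real_derivative - 2 * \<zeta> u * I u) (at u within {x..y})"
      using that \<open>u \<in> {x..y}\<close> by (intro DERIV_subset[OF D]) auto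
    show "- 2 * \<zeta> u * I u \<le> 0"
      using \<zeta>(2)[of u] I[of u] \<open>u \<in> {x..y}\<close> that by simp
  qed
  show "G t \<le> G t0"
    using mono \<open>t0 \<le> t\<close> by simp
  have Z: "0 \<le> Z t"
    unfolding Z_def using \<zeta> by (intro integral_nonneg integrable_continuous_interval)
      (auto elim: continuous_on_subset)
  have KL2: "c\<^sup>2 * G x powr (2 * \<theta>) \<le> I x" if "t0 \<le> x" "0 < G x" for x
  proof -
    have "(c * G x powr \<theta>)\<^sup>2 \<le> (sqrt (I x))\<^sup>2"
      using KL[of x] that \<open>0 < c\<close> by (intro power_mono) auto
    then show ?thesis
      using I[of x] that by (simp add: power_mult_distrib powr_power mult.commute)
  qed
  have pos: "0 < G x" if "0 < G t" "x \<in> {t0..t}" for x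
    using mono[of x t] that by auto
  show "G t \<le> G t0 * exp (- 2 * c\<^sup>2 * integral {t0..t} \<zeta>)" if \<theta>: "\<theta> = 1 / 2"
  proof -
    \<comment> \<open>Only the first case uses the inequality for \<open>I\<close>. In the second
      the right-hand side is nonnegative; in the third a factor at most 1 can only raise the
      negative number \<open>G t0\<close>, so monotonicity suffices.\<close>
    consider "0 < G t" | "G t \<le> 0" "0 \<le> G t0" | "G t0 < 0"
      by linarith
    then show ?thesis
    proof cases
      case 1
      have "G t * exp (2 * c\<^sup>2 * Z t) \<le> G t0 * exp (2 * c\<^sup>2 * Z t0)"
      proof (rule DERIV_within_nonpos_imp_le[OF \<open>t0 \<le> t\<close>])
        fix x assume x: "x \<in> {t0..t}"
        show "((\<lambda>x. G x * exp (2 * c\<^sup>2 * Z x)) has_real_derivative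
            2 * \<zeta> x * exp (2 * c\<^sup>2 * Z x) * (c\<^sup>2 * G x - I x)) (at x within {t0..t})"
          by (rule derivative_eq_intros DG[OF x] DZ[OF x] refl)+ (simp add: algebra_simps)
        have "c\<^sup>2 * G x \<le> I x"
          using KL2[of x] pos[OF 1 x] x \<theta> by simp
        then show "2 * \<zeta> x * exp (2 * c\<^sup>2 * Z x) * (c\<^sup>2 * G x - I x) \<le> 0"
          using \<zeta>(2)[of x] x by (intro mult_nonneg_nonpos) auto
      qed
      moreover have "Z t0 = 0" by (simp add: Z_def)
      ultimately have "G t * exp (2 * c\<^sup>2 * Z t) \<le> G t0"
        by simp
      then show ?thesis
        by (simp add: exp_minus field_simps flip: Z_def)
    next
      case 2
      then show ?thesis
        by (intro order_trans[OF 2(1)]) simp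
    next
      case 3
      have "exp (- 2 * c\<^sup>2 * Z t) \<le> 1"
        using Z by simp
      then have "G t0 \<le> G t0 * exp (- 2 * c\<^sup>2 * Z t)"
        using 3 mult_left_mono_neg[of "exp (- 2 * c\<^sup>2 * Z t)" 1 "G t0"] by simp
      then show ?thesis
        using \<open>G t \<le> G t0\<close> by (simp flip: Z_def)
    qed
  qed
  show "G t \<le> (G t0 powr (1 - 2 * \<theta>) + 2 * c\<^sup>2 * (2 * \<theta> - 1) * integral {t0..t} \<zeta>)
               powr (- 1 / (2 * \<theta> - 1))" if \<theta>: "1 / 2 < \<theta>"
  proof (cases "0 < G t")
    \<comment> \<open>A value of \<open>powr\<close> is never negative, whatever its base, so it
      dominates a nonpositive \<open>G t\<close>.\<close>
    case False
    then show ?thesis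
      by (intro order_trans[OF _ powr_ge_zero]) simp
  next
    case True
    \<comment> \<open>Differentiating \<open>G powr (- k)\<close> produces
      \<open>G powr (- k - 1)\<close>, and \<open>k + 1 = 2 * \<theta>\<close> is the exponent in
      the squared inequality, so the powers of \<open>G\<close> cancel.\<close>
    define k where "k = 2 * \<theta> - 1"
    have k: "0 < k" "1 - 2 * \<theta> = - k" using \<theta> by (auto simp: k_def)
    have "2 * c\<^sup>2 * k * Z t - G t powr (- k) \<le> 2 * c\<^sup>2 * k * Z t0 - G t0 powr (- k)"
    proof (rule DERIV_within_nonpos_imp_le[OF \<open>t0 \<le> t\<close>])
      fix x assume x: "x \<in> {t0..t}"
      show "((\<lambda>x. 2 * c\<^sup>2 * k * Z x - G x powr (- k)) has_real_derivative
          2 * k * \<zeta> x * (c\<^sup>2 - G x powr (- k - 1) * I x)) (at x within {t0..t})"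
        by (rule derivative_eq_intros DG[OF x] DZ[OF x] refl pos[OF True x])+
          (use pos[OF True x] in \<open>simp add: algebra_simps powr_diff\<close>)
      have "G x powr (- k - 1) * (c\<^sup>2 * G x powr (k + 1)) \<le> G x powr (- k - 1) * I x"
        using KL2[of x] pos[OF True x] x by (intro mult_left_mono) (auto simp: k_def)
      moreover have "G x powr (- k - 1) * G x powr (k + 1) = 1"
        using pos[OF True x] by (simp flip: powr_add)
      ultimately have "c\<^sup>2 \<le> G x powr (- k - 1) * I x"
        by (simp add: mult.left_commute)
      then show "2 * k * \<zeta> x * (c\<^sup>2 - G x powr (- k - 1) * I x) \<le> 0"
        using \<zeta>(2)[of x] x k by (intro mult_nonneg_nonpos) auto
    qed
    moreover have "Z t0 = 0" by (simp add: Z_def)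
    ultimately have le: "G t0 powr (- k) + 2 * c\<^sup>2 * k * Z t \<le> G t powr (- k)"
      by simp
    have "0 < G t0"
      using pos[OF True] \<open>t0 \<le> t\<close> by simp
    then have "0 < G t0 powr (- k) + 2 * c\<^sup>2 * k * Z t"
      using Z k by (intro add_pos_nonneg) auto
    \<comment> \<open>The exponent is negative and the bases are positive: the inequality is
      reversed and \<open>G t\<close> reappears on the left.\<close>
    then have "(G t powr (- k)) powr (- 1 / k) \<le> (G t0 powr (- k) + 2 * c\<^sup>2 * k * Z t) powr (- 1 / k)"
      using le k by (intro powr_mono2') auto
    moreover have "(G t powr (- k)) powr (- 1 / k) = G t"
      using True k by (simp add: powr_powr)
    ultimately show ?thesis
      unfolding k(2) Z_def[symmetric] k_def[symmetric] by simp
  qed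
qed

section \<open>Integration against narrowly continuous curves\<close>

lemma prob_measuresD:
  assumes "\<mu> \<in> prob_measures K"
  shows "prob_space \<mu>" "sets \<mu> = sets (restrict_space borel K)" "space \<mu> = K"
proof -
  show *: "prob_space \<mu>" "sets \<mu> = sets (restrict_space borel K)"
    using assms by (auto simp: prob_measures_def)
  show "space \<mu> = K"
    using sets_eq_imp_space_eq[OF *(2)] by (simp add: space_restrict_space)
qed

lemma borel_measurable_prob_measures:
  fixes f :: "'a::topological_space \<Rightarrow> 'b::topological_space"
  assumes "\<mu> \<in> prob_measures K" "continuous_on K f"
  shows "f \<in> borel_measurable \<mu>"
  using borel_measurable_continuous_on_restrict[OF assms(2)]
    measurable_cong_sets[OF prob_measuresD(2)[OF assms(1)] refl] by blast

lemma integrable_prob_measures: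
  fixes f :: "'a::topological_space \<Rightarrow> 'b::euclidean_space"
  assumes \<mu>: "\<mu> \<in> prob_measures K" and "compact K" and f: "continuous_on K f"
  shows "integrable \<mu> f"
proof -
  interpret prob_space \<mu> using \<mu> by (rule prob_measuresD)
  obtain B where "\<And>x. x \<in> K \<Longrightarrow> norm (f x) \<le> B"
    using compact_imp_bounded[OF compact_continuous_image[OF f \<open>compact K\<close>]]
    by (auto simp: bounded_iff)
  then show ?thesis
    by (intro integrable_const_bound[of _ B] borel_measurable_prob_measures[OF \<mu> f])
      (auto simp: prob_measuresD(3)[OF \<mu>])
qed

text \<open>The sigma-algebra of \<open>\<mu>\<close> is that of the subspace \<open>K\<close>, so
  joint measurability passes through the inclusion of \<open>K\<close>; second countability
  identifies the product of the Borel algebras with the Borel algebra of the product.\<close>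

lemma borel_measurable_pair_prob_measures:
  fixes F :: "'a::second_countable_topology \<times> 'b::second_countable_topology \<Rightarrow> 'c::topological_space"
  assumes \<mu>: "\<mu> \<in> prob_measures K" and D: "sets D = sets borel" and F: "continuous_on UNIV F"
  shows "(\<lambda>z. F (fst z, snd z)) \<in> borel_measurable (D \<Otimes>\<^sub>M \<mu>)"
proof -
  have [measurable]: "(\<lambda>x. x) \<in> borel_measurable \<mu>"
    by (rule borel_measurable_prob_measures[OF \<mu>]) (rule continuous_on_id)
  have 1: "(\<lambda>z. (fst z, snd z)) \<in> (D \<Otimes>\<^sub>M \<mu>) \<rightarrow>\<^sub>M (borel \<Otimes>\<^sub>M borel)"
  proof (rule measurable_Pair)
    show "fst \<in> D \<Otimes>\<^sub>M \<mu> \<rightarrow>\<^sub>M borel"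
      using measurable_fst[of D \<mu>] measurable_cong_sets[OF refl D] by blast
    show "snd \<in> D \<Otimes>\<^sub>M \<mu> \<rightarrow>\<^sub>M borel"
      using measurable_compose[OF measurable_snd, of "\<lambda>x. x" \<mu> borel D] by simp
  qed
  have "F \<in> borel_measurable (borel \<Otimes>\<^sub>M borel)"
    unfolding borel_prod using F by (rule borel_measurable_continuous_onI)
  from measurable_compose[OF 1 this] show ?thesis .
qed

lemma borel_measurable_integral_prob_measures:
  fixes F :: "'a \<times> 'b::topological_space \<Rightarrow> 'c::{banach,second_countable_topology}"
  assumes \<mu>: "\<mu> \<in> prob_measures K" and F: "(\<lambda>z. F (fst z, snd z)) \<in> borel_measurable (D \<Otimes>\<^sub>M \<mu>)"
  shows "(\<lambda>x. \<integral>w. F (x, w) \<partial>\<mu>) \<in> borel_measurable D"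
proof -
  interpret prob_space \<mu> using \<mu> by (rule prob_measuresD)
  show ?thesis
    using F by (intro borel_measurable_lebesgue_integral) (simp add: case_prod_beta)
qed

section \<open>Continuity of integrals along narrowly continuous curves\<close>

lemma continuous_on_narrow_topologyD:
  assumes "continuous_map (top_of_set S) (narrow_topology K) \<rho>"
  shows "t \<in> S \<Longrightarrow> \<rho> t \<in> prob_measures K"
    and "continuous_on K f \<Longrightarrow> continuous_on S (\<lambda>t. \<integral>\<omega>. f \<omega> \<partial>\<rho> t :: real)"
proof -
  have "topspace (narrow_topology K) \<subseteq> prob_measures K"
    unfolding narrow_topology_def topology_generated_by_topspace by blast
  then show P: "t \<in> S \<Longrightarrow> \<rho> t \<in> prob_measures K" for t
    using assms unfolding continuous_map_def by auto
  assume f: "continuous_on K f"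
  have "continuous_map (top_of_set S) euclidean (\<lambda>t. \<integral>\<omega>. f \<omega> \<partial>\<rho> t)"
    unfolding continuous_map_def
  proof (intro conjI allI impI)
    fix V :: "real set" assume "openin euclidean V"
    then have "openin (narrow_topology K) {\<mu> \<in> prob_measures K. (\<integral>\<omega>. f \<omega> \<partial>\<mu>) \<in> V}"
      unfolding narrow_topology_def using f by (intro topology_generated_by_Basis) auto
    then have "openin (top_of_set S)
        {t \<in> topspace (top_of_set S). \<rho> t \<in> {\<mu> \<in> prob_measures K. (\<integral>\<omega>. f \<omega> \<partial>\<mu>) \<in> V}}"
      using assms unfolding continuous_map_def by blast
    moreover have "{t \<in> topspace (top_of_set S). \<rho> t \<in> {\<mu> \<in> prob_measures K. (\<integral>\<omega>. f \<omega> \<partial>\<mu>) \<in> V}}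
        = {t \<in> topspace (top_of_set S). (\<integral>\<omega>. f \<omega> \<partial>\<rho> t) \<in> V}"
      using P by auto
    ultimately show "openin (top_of_set S) {t \<in> topspace (top_of_set S). (\<integral>\<omega>. f \<omega> \<partial>\<rho> t) \<in> V}"
      by simp
  qed auto
  then show "continuous_on S (\<lambda>t. \<integral>\<omega>. f \<omega> \<partial>\<rho> t)"
    by simp
qed

lemma continuous_on_integral_narrow_uniform:
  fixes F :: "real \<Rightarrow> 'a::topological_space \<Rightarrow> real"
  assumes \<rho>: "continuous_map (top_of_set S) (narrow_topology K) \<rho>" and "compact K"
    and F: "\<And>t. t \<in> S \<Longrightarrow> continuous_on K (F t)"
    and unif: "\<And>s e. s \<in> S \<Longrightarrow> 0 < e \<Longrightarrow> \<forall>\<^sub>F t in at s within S. \<forall>\<omega>\<in>K. \<bar>F t \<omega> - F s \<omega>\<bar> \<le> e"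
  shows "continuous_on S (\<lambda>t. \<integral>\<omega>. F t \<omega> \<partial>\<rho> t)"
  unfolding continuous_on_def
proof
  fix s assume s: "s \<in> S"
  have "((\<lambda>t. (\<integral>\<omega>. F t \<omega> \<partial>\<rho> t) - (\<integral>\<omega>. F s \<omega> \<partial>\<rho> t)) \<longlongrightarrow> 0) (at s within S)"
  proof (rule tendstoI)
    fix e :: real assume "0 < e"
    have "\<forall>\<^sub>F t in at s within S. t \<in> S"
      by (simp add: eventually_at_filter)
    with unif[OF s half_gt_zero[OF \<open>0 < e\<close>]]
    show "\<forall>\<^sub>F t in at s within S. dist ((\<integral>\<omega>. F t \<omega> \<partial>\<rho> t) - (\<integral>\<omega>. F s \<omega> \<partial>\<rho> t)) 0 < e"
    proof eventually_elim
      case (elim t)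
      then have \<mu>: "\<rho> t \<in> prob_measures K"
        using continuous_on_narrow_topologyD(1)[OF \<rho>] by blast
      interpret prob_space "\<rho> t" using \<mu> by (rule prob_measuresD)
      have int: "integrable (\<rho> t) (F t)" "integrable (\<rho> t) (F s)"
        using integrable_prob_measures[OF \<mu> \<open>compact K\<close> F] s elim by auto
      have "\<bar>\<integral>\<omega>. F t \<omega> - F s \<omega> \<partial>\<rho> t\<bar> \<le> (\<integral>\<omega>. \<bar>F t \<omega> - F s \<omega>\<bar> \<partial>\<rho> t)"
        by (rule integral_abs_bound)
      also have "\<dots> \<le> (\<integral>\<omega>. e / 2 \<partial>\<rho> t)"
        using int elim by (intro integral_mono) (auto simp: prob_measuresD(3)[OF \<mu>])
      also have "\<dots> = e / 2"
        using prob_space by simp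
      finally show ?case
        using int \<open>0 < e\<close> by simp
    qed
  qed
  moreover have "((\<lambda>t. \<integral>\<omega>. F s \<omega> \<partial>\<rho> t) \<longlongrightarrow> (\<integral>\<omega>. F s \<omega> \<partial>\<rho> s)) (at s within S)"
    using continuous_on_narrow_topologyD(2)[OF \<rho> F[OF s]] s unfolding continuous_on_def by blast
  ultimately show "((\<lambda>t. \<integral>\<omega>. F t \<omega> \<partial>\<rho> t) \<longlongrightarrow> (\<integral>\<omega>. F s \<omega> \<partial>\<rho> s)) (at s within S)"
    using tendsto_add[of "\<lambda>t. (\<integral>\<omega>. F t \<omega> \<partial>\<rho> t) - (\<integral>\<omega>. F s \<omega> \<partial>\<rho> t)" 0] by fastforce
qed

lemma continuous_on_integral_dominated:
  fixes g :: "'a \<Rightarrow> 'w::first_countable_topology \<Rightarrow> 'b::euclidean_space"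
  assumes "finite_measure M"
    and meas: "\<And>w. w \<in> S \<Longrightarrow> (\<lambda>x. g x w) \<in> borel_measurable M"
    and AE: "AE x in M. continuous_on S (g x) \<and> (\<forall>w\<in>S. norm (g x w) \<le> B)"
  shows "continuous_on S (\<lambda>w. \<integral>x. g x w \<partial>M)"
  unfolding continuous_on_def
proof
  interpret finite_measure M by fact
  fix w0 assume "w0 \<in> S"
  show "((\<lambda>w. \<integral>x. g x w \<partial>M) \<longlongrightarrow> (\<integral>x. g x w0 \<partial>M)) (at w0 within S)"
    unfolding tendsto_at_iff_sequentially o_def
  proof (intro allI impI)
    fix W :: "nat \<Rightarrow> 'w" assume W: "\<forall>i. W i \<in> S - {w0}" "W \<longlonglongrightarrow> w0"
    show "(\<lambda>i. \<integral>x. g x (W i) \<partial>M) \<longlonglongrightarrow> (\<integral>x. g x w0 \<partial>M)"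
    proof (rule integral_dominated_convergence[where w = "\<lambda>x. B"])
      show "AE x in M. (\<lambda>i. g x (W i)) \<longlonglongrightarrow> g x w0"
        using AE
      proof eventually_elim
        case (elim x)
        then have "(g x \<longlongrightarrow> g x w0) (at w0 within S)"
          using \<open>w0 \<in> S\<close> unfolding continuous_on_def by blast
        then show ?case
          using W unfolding tendsto_at_iff_sequentially o_def by blast
      qed
      show "AE x in M. norm (g x (W i)) \<le> B" for i
        using AE W by auto
    qed (use meas W \<open>w0 \<in> S\<close> in auto)
  qed
qed

lemma bounded_on_compact_Times:
  fixes F :: "'i::finite \<Rightarrow> 'a::topological_space \<times> 'b::topological_space \<Rightarrow> 'c::real_normed_vector"
  assumes "\<And>i. continuous_on UNIV (F i)" "compact C" "compact K"
  obtains B where "0 \<le> B" "\<And>i x w. x \<in> C \<Longrightarrow> w \<in> K \<Longrightarrow> norm (F i (x, w)) \<le> B"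
proof -
  have "\<exists>b. \<forall>x\<in>C. \<forall>w\<in>K. norm (F i (x, w)) \<le> b" for i
  proof -
    have "bounded (F i ` (C \<times> K))"
      using assms(2,3)
      by (intro compact_imp_bounded compact_continuous_image compact_Times
          continuous_on_subset[OF assms(1)]) auto
    then show ?thesis
      unfolding bounded_iff by auto
  qed
  then obtain b where b: "\<And>i x w. x \<in> C \<Longrightarrow> w \<in> K \<Longrightarrow> norm (F i (x, w)) \<le> b i"
    by metis
  show ?thesis
  \<comment> \<open>Summing absolute values gives one nonnegative constant for the whole finite
    family.\<close>
  proof (rule that[of "\<Sum>i\<in>UNIV. \<bar>b i\<bar>"])
    fix i x w assume "x \<in> C" "w \<in> K"
    then have "norm (F i (x, w)) \<le> \<bar>b i\<bar>"
      using b[of x w i] by linarith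
    also have "\<dots> \<le> (\<Sum>i\<in>UNIV. \<bar>b i\<bar>)"
      by (rule member_le_sum) auto
    finally show "norm (F i (x, w)) \<le> (\<Sum>i\<in>UNIV. \<bar>b i\<bar>)" .
  qed (simp add: sum_nonneg)
qed

section \<open>The energy identity\<close>

text \<open>The compact set \<open>C\<close> carries almost every input; the constants that dominate
  integrals over inputs come from joint continuity on \<open>C\<close> times a compact set of
  parameters.\<close>

locale attention_flow =
  fixes Wout :: "('x::finite, 'v::finite) matrix"
    and D :: "('l::{finite,linorder}, 'x) matrix measure"
    and Y :: "'l \<Rightarrow> ('l, 'x) matrix \<Rightarrow> real ^ 'v"
    and \<zeta> :: "real \<Rightarrow> real"
    and K :: "('x, 'k::finite) head set"
    and C :: "('l, 'x) matrix set"
    and \<rho> :: "real \<Rightarrow> ('x, 'k) head measure"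
  assumes data: "data_model D Y"
    and compact_K: "compact K"
    and compact_C: "compact C"
    and AE_C: "AE X in D. X \<in> C"
    and rate_continuous: "continuous_on {0..} \<zeta>"
    and rate_bounded: "bounded (\<zeta> ` {0..})"
    and solution: "weak_solution Wout D Y \<zeta> K \<rho>"
begin

section \<open>Regularity, measurability and bounds of logits and residuals\<close>

sublocale D: prob_space D
  using data by (simp add: data_model_def)

lemma sets_D [measurable_cong]: "sets D = sets borel"
  using data by (simp add: data_model_def)

lemma measurable_Y_nth [measurable]: "(\<lambda>X. Y l X $ j) \<in> borel_measurable D"
proof -
  have "Y l \<in> borel_measurable D"
    using data by (simp add: data_model_def)
  then show ?thesis
    by (rule measurable_compose) (auto intro!: borel_measurable_continuous_onI continuous_intros)
qed

text \<open>Token position and output coordinate are merged into one finite index, so that the chain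
  rule yields a single sum instead of a nested one.\<close>

definition logit :: "'l \<times> 'v \<Rightarrow> ('l, 'x) matrix \<times> ('x, 'k) head \<Rightarrow> real" where
  "logit i z = psi Wout (fst i) (fst z) (snd z) $ snd i"

definition logit_grad :: "'l \<times> 'v \<Rightarrow> ('l, 'x) matrix \<times> ('x, 'k) head \<Rightarrow> ('x, 'k) head" where
  "logit_grad i z = snd (grad (logit i) z)"

text \<open>This is the partial derivative of the averaged cross entropy with respect to the mean
  logit \<open>i\<close>. It does not involve \<open>\<omega>\<close>, which later makes estimates
  uniform on \<open>K\<close>.\<close>

definition residual :: "('x, 'k) head measure \<Rightarrow> 'l \<times> 'v \<Rightarrow> ('l, 'x) matrix \<Rightarrow> real" where
  "residual \<mu> i X = (1 / real CARD('l)) *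
     (softmax (mean_output Wout \<mu> (fst i) X) $ snd i - Y (fst i) X $ snd i)"

text \<open>The candidate obtained by differentiating formally under the expectation; it replaces
  the description operator inside \<open>grad\<close> by an explicit integral.\<close>

definition Phi_grad :: "('x, 'k) head measure \<Rightarrow> ('x, 'k) head \<Rightarrow> ('x, 'k) head" where
  "Phi_grad \<mu> \<omega> = (\<integral>X. (\<Sum>i\<in>UNIV. residual \<mu> i X *\<^sub>R logit_grad i (X, \<omega>)) \<partial>D)"

definition admissible :: "('l, 'x) matrix \<Rightarrow> bool" where
  "admissible X \<longleftrightarrow> X \<in> C \<and> (\<forall>l. one_hot (Y l X))"

lemma AE_admissible: "AE X in D. admissible X"
  using AE_C data by (auto simp: data_model_def admissible_def)

lemma C1_logit: "C1_on UNIV (logit i)"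
  unfolding logit_def by (rule C1_on_psi)

lemma continuous_logit: "continuous_on S (logit i)"
  by (rule C1_on_UNIV_continuous[OF C1_logit])

lemma continuous_logit_grad: "continuous_on S (logit_grad i)"
  unfolding logit_grad_def by (rule continuous_grad_snd[OF C1_logit])

lemma continuous_logit_snd: "continuous_on S (\<lambda>\<omega>. logit i (X, \<omega>))"
  by (rule continuous_on_compose2[OF continuous_logit[of UNIV]]) (auto intro!: continuous_intros)

lemma continuous_logit_grad_snd: "continuous_on S (\<lambda>\<omega>. logit_grad i (X, \<omega>))"
  by (rule continuous_on_compose2[OF continuous_logit_grad[of UNIV]]) (auto intro!: continuous_intros)

lemma measurable_logit [measurable]: "(\<lambda>X. logit i (X, \<omega>)) \<in> borel_measurable D"
proof -
  have "continuous_on UNIV (\<lambda>X. logit i (X, \<omega>))"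
    by (rule continuous_on_compose2[OF continuous_logit[of UNIV]]) (auto intro!: continuous_intros)
  then have "(\<lambda>X. logit i (X, \<omega>)) \<in> borel_measurable borel"
    by (rule borel_measurable_continuous_onI)
  then show ?thesis by measurable
qed

lemma measurable_logit_grad [measurable]: "(\<lambda>X. logit_grad i (X, \<omega>)) \<in> borel_measurable D"
proof -
  have "continuous_on UNIV (\<lambda>X. logit_grad i (X, \<omega>))"
    by (rule continuous_on_compose2[OF continuous_logit_grad[of UNIV]]) (auto intro!: continuous_intros)
  then have "(\<lambda>X. logit_grad i (X, \<omega>)) \<in> borel_measurable borel"
    by (rule borel_measurable_continuous_onI)
  then show ?thesis by measurable
qed

lemma mean_output_nth:
  assumes "\<mu> \<in> prob_measures K"
  shows "mean_output Wout \<mu> l X $ j = (\<integral>\<omega>. logit (l, j) (X, \<omega>) \<partial>\<mu>)"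
proof -
  have "continuous_on K (\<lambda>\<omega>. \<chi> j. logit (l, j) (X, \<omega>))"
    by (intro continuous_intros continuous_logit_snd)
  then have "continuous_on K (psi Wout l X)"
    by (simp add: logit_def)
  then have "integrable \<mu> (psi Wout l X)"
    by (rule integrable_prob_measures[OF assms compact_K])
  then show ?thesis
    unfolding mean_output_def
    by (subst integral_bounded_linear[OF bounded_linear_vec_nth, symmetric]) (auto simp: logit_def)
qed

lemma measurable_mean_output [measurable]:
  assumes "\<mu> \<in> prob_measures K"
  shows "(\<lambda>X. mean_output Wout \<mu> l X $ j) \<in> borel_measurable D"
  unfolding mean_output_nth[OF assms]
  by (rule borel_measurable_integral_prob_measures[OF assms
        borel_measurable_pair_prob_measures[OF assms sets_D continuous_logit]])

lemma measurable_residual [measurable]: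
  assumes "\<mu> \<in> prob_measures K"
  shows "residual \<mu> i \<in> borel_measurable D"
proof -
  note [measurable] = measurable_mean_output[OF assms]
  show ?thesis
    unfolding residual_def[abs_def] softmax_def vec_lambda_beta by measurable
qed

lemma residual_bound:
  assumes "admissible X"
  shows "\<bar>residual \<mu> i X\<bar> \<le> 2"
proof -
  let ?z = "mean_output Wout \<mu> (fst i) X"
  have pos: "0 < (\<Sum>m\<in>UNIV. exp (?z $ m))"
    by (intro sum_pos) auto
  have "exp (?z $ snd i) \<le> (\<Sum>m\<in>UNIV. exp (?z $ m))"
    by (rule member_le_sum) auto
  then have "0 \<le> softmax ?z $ snd i" "softmax ?z $ snd i \<le> 1"
    using pos by (auto simp: softmax_def)
  moreover have "\<bar>Y (fst i) X $ snd i\<bar> \<le> 1"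
    using assms by (auto simp: admissible_def one_hot_def axis_def dest!: spec[of _ "fst i"])
  ultimately have "\<bar>softmax ?z $ snd i - Y (fst i) X $ snd i\<bar> \<le> 2"
    by linarith
  moreover have "1 / real CARD('l) \<le> 1"
    by simp
  ultimately have "(1 / real CARD('l)) * \<bar>softmax ?z $ snd i - Y (fst i) X $ snd i\<bar> \<le> 1 * 2"
    by (intro mult_mono) auto
  then show ?thesis
    by (simp add: residual_def abs_mult)
qed

section \<open>The gradient of the first variation\<close>

lemma measurable_weighted_grad:
  assumes "\<mu> \<in> prob_measures K"
  shows "(\<lambda>X. \<Sum>i\<in>UNIV. residual \<mu> i X *\<^sub>R logit_grad i (X, \<omega>)) \<in> borel_measurable D"
proof -
  note [measurable] = measurable_residual[OF assms]
  show ?thesis by measurable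
qed

lemma sum_UNIV_prod: "(\<Sum>i\<in>UNIV. f i) = (\<Sum>l\<in>UNIV. \<Sum>j\<in>UNIV. f (l, j) :: real)"
  by (simp add: sum.cartesian_product flip: UNIV_Times_UNIV)

lemma Phi_eq:
  "Phi Wout D Y \<mu> \<omega> = (\<integral>X. (\<Sum>i\<in>UNIV. residual \<mu> i X * logit i (X, \<omega>)) \<partial>D)"
  unfolding Phi_def residual_def logit_def sum_UNIV_prod
  by (simp add: inner_vec_def sum_distrib_left mult.assoc)

text \<open>Domination comes from compactness of \<open>C\<close> times the closed unit ball around
  \<open>\<omega>\<close>. At the centre of the open ball the derivative within the ball is the
  unrestricted one, so the gradient exists at every point of the ambient space.\<close>

lemma GDERIV_Phi:
  assumes \<mu>: "\<mu> \<in> prob_measures K"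
  shows "GDERIV (Phi Wout D Y \<mu>) \<omega> :> Phi_grad \<mu> \<omega>"
proof -
  note [measurable] = measurable_residual[OF \<mu>]
  obtain B where B: "0 \<le> B" "\<And>i X w. X \<in> C \<Longrightarrow> w \<in> cball \<omega> 1 \<Longrightarrow> norm (logit i (X, w)) \<le> B"
    using bounded_on_compact_Times[of logit, OF continuous_logit compact_C compact_cball] by blast
  obtain B' where B': "0 \<le> B'" "\<And>i X w. X \<in> C \<Longrightarrow> w \<in> cball \<omega> 1 \<Longrightarrow> norm (logit_grad i (X, w)) \<le> B'"
    using bounded_on_compact_Times[of logit_grad, OF continuous_logit_grad compact_C compact_cball] by blast
  have "((\<lambda>w. \<integral>X. (\<Sum>i\<in>UNIV. residual \<mu> i X * logit i (X, w)) \<partial>D) has_derivative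
      (\<lambda>h. h \<bullet> (\<integral>X. (\<Sum>i\<in>UNIV. residual \<mu> i X *\<^sub>R logit_grad i (X, \<omega>)) \<partial>D))) (at \<omega> within ball \<omega> 1)"
  proof (rule has_derivative_integral[where B = "\<Sum>i\<in>(UNIV :: ('l \<times> 'v) set). 2 * B'"])
    fix w assume w: "w \<in> ball \<omega> 1"
    show "integrable D (\<lambda>X. \<Sum>i\<in>UNIV. residual \<mu> i X * logit i (X, w))"
    proof (intro Bochner_Integration.integrable_sum D.integrable_const_bound[of _ "2 * B"])
      show "AE X in D. norm (residual \<mu> i X * logit i (X, w)) \<le> 2 * B" for i
        using AE_admissible
      proof eventually_elim
        case (elim X)
        then have "\<bar>residual \<mu> i X\<bar> * \<bar>logit i (X, w)\<bar> \<le> 2 * B"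
          using residual_bound[OF elim] B w by (intro mult_mono) (auto simp: admissible_def)
        then show ?case by (simp add: abs_mult)
      qed
    qed simp
  next
    show "AE X in D. \<forall>w\<in>ball \<omega> 1.
      ((\<lambda>w. \<Sum>i\<in>UNIV. residual \<mu> i X * logit i (X, w)) has_derivative
        (\<lambda>h. h \<bullet> (\<Sum>i\<in>UNIV. residual \<mu> i X *\<^sub>R logit_grad i (X, w)))) (at w within ball \<omega> 1) \<and>
      norm (\<Sum>i\<in>UNIV. residual \<mu> i X *\<^sub>R logit_grad i (X, w)) \<le> (\<Sum>i\<in>(UNIV :: ('l \<times> 'v) set). 2 * B')"
      using AE_admissible
    proof eventually_elim
      case (elim X)
      show ?case
      proof (intro ballI conjI)
        fix w assume w: "w \<in> ball \<omega> 1"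
        have "((\<lambda>w. logit i (X, w)) has_derivative (\<lambda>h. h \<bullet> logit_grad i (X, w))) (at w within ball \<omega> 1)" for i
          using GDERIV_snd[OF C1_logit] unfolding gderiv_def logit_grad_def
          by (rule has_derivative_at_withinI)
        then have "((\<lambda>w. \<Sum>i\<in>UNIV. residual \<mu> i X * logit i (X, w)) has_derivative
          (\<lambda>h. \<Sum>i\<in>UNIV. residual \<mu> i X * (h \<bullet> logit_grad i (X, w)))) (at w within ball \<omega> 1)"
          by (intro has_derivative_sum has_derivative_mult_right)
        then show "((\<lambda>w. \<Sum>i\<in>UNIV. residual \<mu> i X * logit i (X, w)) has_derivative
          (\<lambda>h. h \<bullet> (\<Sum>i\<in>UNIV. residual \<mu> i X *\<^sub>R logit_grad i (X, w)))) (at w within ball \<omega> 1)"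
          by (simp add: inner_sum_right)
        show "norm (\<Sum>i\<in>UNIV. residual \<mu> i X *\<^sub>R logit_grad i (X, w)) \<le> (\<Sum>i\<in>(UNIV :: ('l \<times> 'v) set). 2 * B')"
        proof (rule sum_norm_le)
          show "norm (residual \<mu> i X *\<^sub>R logit_grad i (X, w)) \<le> 2 * B'" for i
            unfolding norm_scaleR
            using residual_bound[OF elim] B' w elim by (intro mult_mono) (auto simp: admissible_def)
        qed
      qed
    qed
  qed (auto simp: D.finite_measure_axioms)
  then show ?thesis
    unfolding gderiv_def Phi_eq[abs_def] Phi_grad_def using at_within_open[of \<omega> "ball \<omega> 1"] by simp
qed

lemma grad_Phi: "\<mu> \<in> prob_measures K \<Longrightarrow> grad (Phi Wout D Y \<mu>) = Phi_grad \<mu>"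
  using grad_eqI[OF GDERIV_Phi] by blast

text \<open>Fixing one constant by choice lets all later estimates share it.\<close>

definition grad_bound :: real where
  "grad_bound = (SOME B. 0 \<le> B \<and> (\<forall>i. \<forall>X\<in>C. \<forall>\<omega>\<in>K. norm (logit_grad i (X, \<omega>)) \<le> B))"

lemma grad_bound:
  shows "0 \<le> grad_bound"
    and "X \<in> C \<Longrightarrow> \<omega> \<in> K \<Longrightarrow> norm (logit_grad i (X, \<omega>)) \<le> grad_bound"
proof -
  have "\<exists>B. 0 \<le> B \<and> (\<forall>i. \<forall>X\<in>C. \<forall>\<omega>\<in>K. norm (logit_grad i (X, \<omega>)) \<le> B)"
    using bounded_on_compact_Times[of logit_grad, OF continuous_logit_grad compact_C compact_K] by metis
  from someI_ex[OF this, folded grad_bound_def]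
  show "0 \<le> grad_bound"
    and "X \<in> C \<Longrightarrow> \<omega> \<in> K \<Longrightarrow> norm (logit_grad i (X, \<omega>)) \<le> grad_bound"
    by blast+
qed

lemma norm_weighted_grad_le:
  assumes "admissible X" "\<omega> \<in> K"
  shows "norm (\<Sum>i\<in>UNIV. residual \<mu> i X *\<^sub>R logit_grad i (X, \<omega>))
    \<le> (\<Sum>i\<in>(UNIV :: ('l \<times> 'v) set). 2 * grad_bound)"
proof (rule sum_norm_le)
  show "norm (residual \<mu> i X *\<^sub>R logit_grad i (X, \<omega>)) \<le> 2 * grad_bound" for i
    unfolding norm_scaleR using residual_bound[OF assms(1)] assms grad_bound
    by (intro mult_mono) (auto simp: admissible_def)
qed

definition Phi_grad_bound :: real where
  "Phi_grad_bound = (\<Sum>i\<in>(UNIV :: ('l \<times> 'v) set). 2 * grad_bound)"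

lemma integrable_weighted_grad:
  assumes \<mu>: "\<mu> \<in> prob_measures K" and "\<omega> \<in> K"
  shows "integrable D (\<lambda>X. \<Sum>i\<in>UNIV. residual \<mu> i X *\<^sub>R logit_grad i (X, \<omega>))"
proof (rule D.integrable_const_bound)
  show "(\<lambda>X. \<Sum>i\<in>UNIV. residual \<mu> i X *\<^sub>R logit_grad i (X, \<omega>)) \<in> borel_measurable D"
    by (rule measurable_weighted_grad[OF \<mu>])
  show "AE X in D. norm (\<Sum>i\<in>UNIV. residual \<mu> i X *\<^sub>R logit_grad i (X, \<omega>)) \<le> Phi_grad_bound"
    using AE_admissible norm_weighted_grad_le[OF _ \<open>\<omega> \<in> K\<close>] unfolding Phi_grad_bound_def by auto
qed

lemma norm_Phi_grad_le:
  assumes \<mu>: "\<mu> \<in> prob_measures K" and "\<omega> \<in> K"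
  shows "norm (Phi_grad \<mu> \<omega>) \<le> Phi_grad_bound"
proof -
  have "norm (Phi_grad \<mu> \<omega>) \<le> (\<integral>X. norm (\<Sum>i\<in>UNIV. residual \<mu> i X *\<^sub>R logit_grad i (X, \<omega>)) \<partial>D)"
    unfolding Phi_grad_def by (rule integral_norm_bound)
  also have "\<dots> \<le> (\<integral>X. Phi_grad_bound \<partial>D)"
    using AE_admissible norm_weighted_grad_le[OF _ \<open>\<omega> \<in> K\<close>] integrable_weighted_grad[OF assms]
    unfolding Phi_grad_bound_def by (intro integral_mono_AE) auto
  finally show ?thesis
    by (simp add: D.prob_space)
qed

lemma continuous_Phi_grad:
  assumes \<mu>: "\<mu> \<in> prob_measures K"
  shows "continuous_on K (Phi_grad \<mu>)"
  unfolding Phi_grad_def[abs_def]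
proof (rule continuous_on_integral_dominated)
  show "(\<lambda>X. \<Sum>i\<in>UNIV. residual \<mu> i X *\<^sub>R logit_grad i (X, \<omega>)) \<in> borel_measurable D" if "\<omega> \<in> K" for \<omega>
    using integrable_weighted_grad[OF \<mu> that] by (rule borel_measurable_integrable)
  show "AE X in D. continuous_on K (\<lambda>\<omega>. \<Sum>i\<in>UNIV. residual \<mu> i X *\<^sub>R logit_grad i (X, \<omega>)) \<and>
     (\<forall>\<omega>\<in>K. norm (\<Sum>i\<in>UNIV. residual \<mu> i X *\<^sub>R logit_grad i (X, \<omega>)) \<le> Phi_grad_bound)"
    using AE_admissible unfolding Phi_grad_bound_def
    by eventually_elim
      (intro conjI ballI continuous_intros continuous_logit_grad_snd norm_weighted_grad_le)
qed (rule D.finite_measure_axioms)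

section \<open>Continuity in time along the solution\<close>

lemma narrow: "continuous_map (top_of_set {0..}) (narrow_topology K) \<rho>"
  using solution by (simp add: weak_solution_def)

lemma \<rho>_in: "0 \<le> t \<Longrightarrow> \<rho> t \<in> prob_measures K"
  using continuous_on_narrow_topologyD(1)[OF narrow] by simp

lemma continuous_mean_output: "continuous_on {0..} (\<lambda>t. mean_output Wout (\<rho> t) (l :: 'l) X $ j)"
proof -
  have "continuous_on {0..} (\<lambda>t. \<integral>\<omega>. logit (l, j) (X, \<omega>) \<partial>\<rho> t)"
    by (rule continuous_on_narrow_topologyD(2)[OF narrow continuous_logit_snd])
  then show ?thesis
    by (rule continuous_on_eq) (simp add: mean_output_nth \<rho>_in)
qed

lemma continuous_residual: "continuous_on {0..} (\<lambda>t. residual (\<rho> t) i X)"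
proof -
  have "(\<Sum>m\<in>UNIV. exp (mean_output Wout (\<rho> t) l X $ m)) \<noteq> 0" for t l
    using sum_pos[of UNIV "\<lambda>m. exp (mean_output Wout (\<rho> t) l X $ m)"] by auto
  then show ?thesis
    unfolding residual_def softmax_def vec_lambda_beta
    by (intro continuous_intros continuous_mean_output) auto
qed

text \<open>Time enters the gradient only through the residuals, which are independent of
  \<open>\<omega>\<close>. The expected change \<open>\<delta>\<close> of the residuals, times
  \<open>grad_bound\<close>, therefore controls all \<open>\<omega>\<close> in \<open>K\<close> at
  once, and it tends to 0 by dominated convergence.\<close>

lemma Phi_grad_uniform:
  assumes "0 \<le> s" "0 < e"
  shows "\<forall>\<^sub>F t in at s within {0..}. \<forall>\<omega>\<in>K. norm (Phi_grad (\<rho> t) \<omega> - Phi_grad (\<rho> s) \<omega>) \<le> e"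
proof -
  define \<delta> where "\<delta> t = (\<integral>X. (\<Sum>i\<in>UNIV. \<bar>residual (\<rho> t) i X - residual (\<rho> s) i X\<bar> * grad_bound) \<partial>D)" for t
  have bd: "\<bar>residual (\<rho> t) i X - residual (\<rho> s) i X\<bar> * grad_bound \<le> 4 * grad_bound" if "admissible X" for t i X
    using residual_bound[OF that, of "\<rho> t" i] residual_bound[OF that, of "\<rho> s" i] grad_bound
    by (intro mult_right_mono) auto
  have meas: "(\<lambda>X. \<Sum>i\<in>UNIV. \<bar>residual (\<rho> t) i X - residual (\<rho> s) i X\<bar> * grad_bound) \<in> borel_measurable D"
    if "0 \<le> t" for t
  proof -
    note [measurable] = measurable_residual[OF \<rho>_in[OF that]] measurable_residual[OF \<rho>_in[OF \<open>0 \<le> s\<close>]]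
    show ?thesis by measurable
  qed
  have bd': "AE X in D. norm (\<Sum>i\<in>UNIV. \<bar>residual (\<rho> t) i X - residual (\<rho> s) i X\<bar> * grad_bound)
      \<le> (\<Sum>i\<in>(UNIV :: ('l \<times> 'v) set). 4 * grad_bound)" for t
    using AE_admissible
  proof eventually_elim
    case (elim X)
    show ?case
      using bd[OF elim] grad_bound(1) by (intro sum_norm_le) simp
  qed
  have "continuous_on {0..} \<delta>"
    unfolding \<delta>_def
  proof (rule continuous_on_integral_dominated[where B = "\<Sum>i\<in>(UNIV :: ('l \<times> 'v) set). 4 * grad_bound"])
    show "AE X in D. continuous_on {0..} (\<lambda>t. \<Sum>i\<in>UNIV. \<bar>residual (\<rho> t) i X - residual (\<rho> s) i X\<bar> * grad_bound) \<and>
       (\<forall>t\<in>{0..}. norm (\<Sum>i\<in>UNIV. \<bar>residual (\<rho> t) i X - residual (\<rho> s) i X\<bar> * grad_bound)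
          \<le> (\<Sum>i\<in>(UNIV :: ('l \<times> 'v) set). 4 * grad_bound))"
      using AE_admissible
    proof eventually_elim
      case (elim X)
      have "norm (\<Sum>i\<in>UNIV. \<bar>residual (\<rho> t) i X - residual (\<rho> s) i X\<bar> * grad_bound)
          \<le> (\<Sum>i\<in>(UNIV :: ('l \<times> 'v) set). 4 * grad_bound)" for t
        using bd[OF elim] grad_bound(1) by (intro sum_norm_le) simp
      moreover have "continuous_on {0..} (\<lambda>t. \<Sum>i\<in>UNIV. \<bar>residual (\<rho> t) i X - residual (\<rho> s) i X\<bar> * grad_bound)"
        by (intro continuous_intros continuous_residual)
      ultimately show ?case by blast
    qed
  qed (use meas D.finite_measure_axioms in auto)
  then have "(\<delta> \<longlongrightarrow> \<delta> s) (at s within {0..})"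
    using \<open>0 \<le> s\<close> by (auto simp: continuous_on_def)
  moreover have "\<delta> s = 0"
    by (simp add: \<delta>_def)
  ultimately have "\<forall>\<^sub>F t in at s within {0..}. \<delta> t < e"
    using \<open>0 < e\<close> by (auto dest: order_tendstoD)
  moreover have "\<forall>\<^sub>F t in at s within {0..}. t \<in> {0..}"
    by (simp add: eventually_at_filter)
  ultimately show ?thesis
  proof eventually_elim
    case (elim t)
    show ?case
    proof
      fix \<omega> assume \<omega>: "\<omega> \<in> K"
      have t: "0 \<le> t" using elim by simp
      note int = integrable_weighted_grad[OF \<rho>_in[OF t] \<omega>] integrable_weighted_grad[OF \<rho>_in[OF \<open>0 \<le> s\<close>] \<omega>]
      have "norm (Phi_grad (\<rho> t) \<omega> - Phi_grad (\<rho> s) \<omega>)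
        = norm (\<integral>X. (\<Sum>i\<in>UNIV. residual (\<rho> t) i X *\<^sub>R logit_grad i (X, \<omega>)) -
              (\<Sum>i\<in>UNIV. residual (\<rho> s) i X *\<^sub>R logit_grad i (X, \<omega>)) \<partial>D)"
        unfolding Phi_grad_def using int by simp
      also have "\<dots> \<le> (\<integral>X. norm ((\<Sum>i\<in>UNIV. residual (\<rho> t) i X *\<^sub>R logit_grad i (X, \<omega>)) -
              (\<Sum>i\<in>UNIV. residual (\<rho> s) i X *\<^sub>R logit_grad i (X, \<omega>))) \<partial>D)"
        by (rule integral_norm_bound)
      also have "\<dots> \<le> \<delta> t"
        unfolding \<delta>_def
      proof (rule integral_mono_AE)
        show "integrable D (\<lambda>X. norm ((\<Sum>i\<in>UNIV. residual (\<rho> t) i X *\<^sub>R logit_grad i (X, \<omega>)) -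
              (\<Sum>i\<in>UNIV. residual (\<rho> s) i X *\<^sub>R logit_grad i (X, \<omega>))))"
          using int by simp
        show "integrable D (\<lambda>X. \<Sum>i\<in>UNIV. \<bar>residual (\<rho> t) i X - residual (\<rho> s) i X\<bar> * grad_bound)"
          by (rule D.integrable_const_bound[OF bd' meas[OF t]])
        show "AE X in D. norm ((\<Sum>i\<in>UNIV. residual (\<rho> t) i X *\<^sub>R logit_grad i (X, \<omega>)) -
              (\<Sum>i\<in>UNIV. residual (\<rho> s) i X *\<^sub>R logit_grad i (X, \<omega>)))
            \<le> (\<Sum>i\<in>UNIV. \<bar>residual (\<rho> t) i X - residual (\<rho> s) i X\<bar> * grad_bound)"
          using AE_admissible
        proof eventually_elim
          case (elim X)
          then have "X \<in> C" by (simp add: admissible_def)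
          show ?case
            unfolding sum_subtractf[symmetric] scaleR_left_diff_distrib[symmetric]
          proof (rule sum_norm_le)
            show "norm ((residual (\<rho> t) i X - residual (\<rho> s) i X) *\<^sub>R logit_grad i (X, \<omega>))
                \<le> \<bar>residual (\<rho> t) i X - residual (\<rho> s) i X\<bar> * grad_bound" for i
              unfolding norm_scaleR real_norm_def
              by (rule mult_left_mono[OF grad_bound(2)[OF \<open>X \<in> C\<close> \<omega>]]) simp
          qed
        qed
      qed
      finally show "norm (Phi_grad (\<rho> t) \<omega> - Phi_grad (\<rho> s) \<omega>) \<le> e"
        using elim by simp
    qed
  qed
qed

section \<open>Time derivatives of the mean logits\<close>

definition velocity :: "'l \<times> 'v \<Rightarrow> ('l, 'x) matrix \<Rightarrow> real \<Rightarrow> real" where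
  "velocity i X t = - 2 * \<zeta> t * (\<integral>\<omega>. logit_grad i (X, \<omega>) \<bullet> Phi_grad (\<rho> t) \<omega> \<partial>\<rho> t)"

text \<open>Continuity of the right-hand side is what upgrades the weak derivative to a classical
  one.\<close>

lemma continuous_velocity: "continuous_on {0..} (velocity i X)"
proof -
  have "continuous_on {0..} (\<lambda>t. \<integral>\<omega>. logit_grad i (X, \<omega>) \<bullet> Phi_grad (\<rho> t) \<omega> \<partial>\<rho> t)"
  proof (rule continuous_on_integral_narrow_uniform[OF narrow compact_K])
    show "continuous_on K (\<lambda>\<omega>. logit_grad i (X, \<omega>) \<bullet> Phi_grad (\<rho> t) \<omega>)" if "t \<in> {0..}" for t
      using that by (intro continuous_intros continuous_logit_grad_snd continuous_Phi_grad \<rho>_in) auto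
  next
    fix s e :: real assume s: "s \<in> {0..}" and "0 < e"
    obtain B where B: "\<And>\<omega>. \<omega> \<in> K \<Longrightarrow> norm (logit_grad i (X, \<omega>)) \<le> B"
      using compact_imp_bounded[OF compact_continuous_image[OF continuous_logit_grad_snd compact_K]]
      unfolding bounded_iff by (metis imageI)
    \<comment> \<open>Adding 1 makes the bound strictly positive, so that the tolerance
      \<open>e / b\<close> makes sense.\<close>
    define b where "b = \<bar>B\<bar> + 1"
    have b: "0 < b" "\<And>\<omega>. \<omega> \<in> K \<Longrightarrow> norm (logit_grad i (X, \<omega>)) \<le> b"
      using B unfolding b_def by force+
    have "\<forall>\<^sub>F t in at s within {0..}. \<forall>\<omega>\<in>K. norm (Phi_grad (\<rho> t) \<omega> - Phi_grad (\<rho> s) \<omega>) \<le> e / b"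
      using s b \<open>0 < e\<close> by (intro Phi_grad_uniform) auto
    then show "\<forall>\<^sub>F t in at s within {0..}. \<forall>\<omega>\<in>K.
       \<bar>logit_grad i (X, \<omega>) \<bullet> Phi_grad (\<rho> t) \<omega> - logit_grad i (X, \<omega>) \<bullet> Phi_grad (\<rho> s) \<omega>\<bar> \<le> e"
    proof eventually_elim
      case (elim t)
      show ?case
      proof
        fix \<omega> assume \<omega>: "\<omega> \<in> K"
        have "\<bar>logit_grad i (X, \<omega>) \<bullet> (Phi_grad (\<rho> t) \<omega> - Phi_grad (\<rho> s) \<omega>)\<bar>
            \<le> norm (logit_grad i (X, \<omega>)) * norm (Phi_grad (\<rho> t) \<omega> - Phi_grad (\<rho> s) \<omega>)"
          by (rule Cauchy_Schwarz_ineq2)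
        also have "\<dots> \<le> b * (e / b)"
          using b \<omega> elim by (intro mult_mono) auto
        finally show "\<bar>logit_grad i (X, \<omega>) \<bullet> Phi_grad (\<rho> t) \<omega> - logit_grad i (X, \<omega>) \<bullet> Phi_grad (\<rho> s) \<omega>\<bar> \<le> e"
          using b by (simp add: inner_diff_right)
      qed
    qed
  qed
  then show ?thesis
    unfolding velocity_def by (intro continuous_intros rate_continuous)
qed

text \<open>For a fixed input the logit is itself an admissible test function of class C1, and
  \<open>velocity\<close> is the right-hand side that the weak equation assigns to it.\<close>

lemma mean_output_has_derivative:
  assumes "0 \<le> t"
  shows "((\<lambda>t. mean_output Wout (\<rho> t) (fst i) X $ snd i) has_real_derivative velocity i X t) (at t within {0..})"
proof (rule weak_derivative_imp_derivative[OF continuous_mean_output continuous_velocity _ assms])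
  fix \<phi> assume \<phi>: "time_test_function \<phi>"
  let ?f = "\<lambda>\<omega>. logit i (X, \<omega>)"
  have "C1_on K ?f"
    by (rule C1_on_UNIV_subset[OF C1_on_snd[OF C1_logit]])
  \<comment> \<open>The integrands need to agree only for nonnegative times, where
    \<open>\<rho> t\<close> is known to be a probability measure on \<open>K\<close>.\<close>
  have cong: "(LBINT t:{0..}. a t) = (LBINT t:{0..}. b t)" if "\<And>t. 0 \<le> t \<Longrightarrow> a t = b t" for a b :: "real \<Rightarrow> real"
    unfolding set_lebesgue_integral_def
    by (rule Bochner_Integration.integral_cong) (simp_all add: that indicator_def)
  have "- (LBINT t:{0..}. deriv \<phi> t * (\<integral>\<omega>. ?f \<omega> \<partial>\<rho> t)) =
        (LBINT t:{0..}. \<phi> t * (- 2 * \<zeta> t * (\<integral>\<omega>. grad ?f \<omega> \<bullet> grad (Phi Wout D Y (\<rho> t)) \<omega> \<partial>\<rho> t)))"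
    using solution \<open>C1_on K ?f\<close> \<phi> unfolding weak_solution_def by (elim conjE allE impE)
  moreover have "(LBINT t:{0..}. deriv \<phi> t * (\<integral>\<omega>. ?f \<omega> \<partial>\<rho> t)) =
      (LBINT t:{0..}. deriv \<phi> t * mean_output Wout (\<rho> t) (fst i) X $ snd i)"
    by (rule cong) (simp add: mean_output_nth \<rho>_in)
  moreover have "(LBINT t:{0..}. \<phi> t * (- 2 * \<zeta> t * (\<integral>\<omega>. grad ?f \<omega> \<bullet> grad (Phi Wout D Y (\<rho> t)) \<omega> \<partial>\<rho> t))) =
      (LBINT t:{0..}. \<phi> t * velocity i X t)"
    by (rule cong) (simp add: grad_Phi \<rho>_in velocity_def grad_snd[OF C1_logit] logit_grad_def)
  ultimately show "- (LBINT t:{0..}. deriv \<phi> t * mean_output Wout (\<rho> t) (fst i) X $ snd i) =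
      (LBINT t:{0..}. \<phi> t * velocity i X t)"
    by simp
qed

section \<open>Time derivative of the expected loss\<close>

definition loss :: "('l, 'x) matrix \<Rightarrow> real \<Rightarrow> real" where
  "loss X t = (1 / real CARD('l)) *
     (\<Sum>l\<in>UNIV. cross_entropy (Y l X) (mean_output Wout (\<rho> t) l X))"

text \<open>The gradient of log-sum-exp is \<open>softmax\<close>, so the outer derivative in logit
  \<open>i\<close> is exactly \<open>residual\<close>.\<close>

lemma loss_has_derivative:
  assumes "0 \<le> t"
  shows "(loss X has_real_derivative (\<Sum>i\<in>UNIV. residual (\<rho> t) i X * velocity i X t)) (at t within {0..})"
proof -
  let ?z = "\<lambda>l j t. mean_output Wout (\<rho> t) l X $ j"
  have dz: "(?z l j has_real_derivative velocity (l, j) X t) (at t within {0..})" for l j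
    using mean_output_has_derivative[OF assms, of "(l, j)" X] by simp
  have pos: "0 < (\<Sum>j\<in>UNIV. exp (?z l j t))" for l
    by (intro sum_pos) auto
  have "((\<lambda>t. cross_entropy (Y l X) (mean_output Wout (\<rho> t) l X)) has_real_derivative
      (\<Sum>j\<in>UNIV. (softmax (mean_output Wout (\<rho> t) l X) $ j - Y l X $ j) * velocity (l, j) X t)) (at t within {0..})" for l
  proof -
    have "((\<lambda>t. ln (\<Sum>j\<in>UNIV. exp (?z l j t)) - (\<Sum>j\<in>UNIV. Y l X $ j * ?z l j t)) has_real_derivative
        1 / (\<Sum>j\<in>UNIV. exp (?z l j t)) * (\<Sum>j\<in>UNIV. exp (?z l j t) * velocity (l, j) X t) -
        (\<Sum>j\<in>UNIV. Y l X $ j * velocity (l, j) X t)) (at t within {0..})"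
    proof (rule DERIV_diff)
      have "((\<lambda>t. \<Sum>j\<in>UNIV. exp (?z l j t)) has_real_derivative
          (\<Sum>j\<in>UNIV. exp (?z l j t) * velocity (l, j) X t)) (at t within {0..})"
        by (intro DERIV_sum DERIV_chain2[OF DERIV_exp dz])
      then show "((\<lambda>t. ln (\<Sum>j\<in>UNIV. exp (?z l j t))) has_real_derivative
          1 / (\<Sum>j\<in>UNIV. exp (?z l j t)) * (\<Sum>j\<in>UNIV. exp (?z l j t) * velocity (l, j) X t)) (at t within {0..})"
        by (rule DERIV_chain2[of ln _ "\<lambda>t. \<Sum>j\<in>UNIV. exp (?z l j t)", OF DERIV_ln_divide[OF pos]])
      show "((\<lambda>t. \<Sum>j\<in>UNIV. Y l X $ j * ?z l j t) has_real_derivative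
          (\<Sum>j\<in>UNIV. Y l X $ j * velocity (l, j) X t)) (at t within {0..})"
        by (intro DERIV_sum DERIV_cmult dz)
    qed
    moreover have "1 / (\<Sum>j\<in>UNIV. exp (?z l j t)) * (\<Sum>j\<in>UNIV. exp (?z l j t) * velocity (l, j) X t) -
        (\<Sum>j\<in>UNIV. Y l X $ j * velocity (l, j) X t) =
        (\<Sum>j\<in>UNIV. (softmax (mean_output Wout (\<rho> t) l X) $ j - Y l X $ j) * velocity (l, j) X t)"
      by (simp add: softmax_def sum_distrib_left left_diff_distrib sum_subtractf)
    ultimately show ?thesis
      by (simp add: cross_entropy_def inner_vec_def)
  qed
  then have "(loss X has_real_derivative (1 / real CARD('l)) * (\<Sum>l\<in>UNIV.
      (\<Sum>j\<in>UNIV. (softmax (mean_output Wout (\<rho> t) l X) $ j - Y l X $ j) * velocity (l, j) X t))) (at t within {0..})"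
    unfolding loss_def[abs_def] by (intro DERIV_cmult DERIV_sum)
  then show ?thesis
    unfolding sum_UNIV_prod by (simp add: residual_def sum_distrib_left mult.assoc)
qed

lemma abs_inner_Phi_grad_le:
  assumes "0 \<le> t" "X \<in> C" "\<omega> \<in> K"
  shows "\<bar>logit_grad i (X, \<omega>) \<bullet> Phi_grad (\<rho> t) \<omega>\<bar> \<le> grad_bound * Phi_grad_bound"
proof -
  have "\<bar>logit_grad i (X, \<omega>) \<bullet> Phi_grad (\<rho> t) \<omega>\<bar> \<le> norm (logit_grad i (X, \<omega>)) * norm (Phi_grad (\<rho> t) \<omega>)"
    by (rule Cauchy_Schwarz_ineq2)
  also have "\<dots> \<le> grad_bound * Phi_grad_bound"
    using assms grad_bound norm_Phi_grad_le[OF \<rho>_in] by (intro mult_mono) auto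
  finally show ?thesis .
qed

lemma velocity_bounded:
  obtains B where "\<And>i X t. 0 \<le> t \<Longrightarrow> X \<in> C \<Longrightarrow> \<bar>velocity i X t\<bar> \<le> B"
proof -
  obtain Z where Z: "\<And>t. 0 \<le> t \<Longrightarrow> \<bar>\<zeta> t\<bar> \<le> Z"
    using rate_bounded by (auto simp: bounded_iff)
  have "\<bar>velocity i X t\<bar> \<le> 2 * Z * (grad_bound * Phi_grad_bound)" if "0 \<le> t" "X \<in> C" for i X t
  proof -
    note \<mu> = \<rho>_in[OF \<open>0 \<le> t\<close>]
    interpret \<mu>: prob_space "\<rho> t" using \<mu> by (rule prob_measuresD)
    have int: "integrable (\<rho> t) (\<lambda>\<omega>. logit_grad i (X, \<omega>) \<bullet> Phi_grad (\<rho> t) \<omega>)"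
      by (intro integrable_prob_measures[OF \<mu> compact_K] continuous_intros continuous_logit_grad_snd
          continuous_Phi_grad \<mu>)
    have "\<bar>\<integral>\<omega>. logit_grad i (X, \<omega>) \<bullet> Phi_grad (\<rho> t) \<omega> \<partial>\<rho> t\<bar>
        \<le> (\<integral>\<omega>. \<bar>logit_grad i (X, \<omega>) \<bullet> Phi_grad (\<rho> t) \<omega>\<bar> \<partial>\<rho> t)"
      by (rule integral_abs_bound)
    also have "\<dots> \<le> (\<integral>\<omega>. grad_bound * Phi_grad_bound \<partial>\<rho> t)"
    proof (rule integral_mono)
      fix \<omega> assume "\<omega> \<in> space (\<rho> t)"
      then show "\<bar>logit_grad i (X, \<omega>) \<bullet> Phi_grad (\<rho> t) \<omega>\<bar> \<le> grad_bound * Phi_grad_bound"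
        using abs_inner_Phi_grad_le[OF that] prob_measuresD(3)[OF \<mu>] by blast
    qed (use int in simp_all)
    finally have "\<bar>\<integral>\<omega>. logit_grad i (X, \<omega>) \<bullet> Phi_grad (\<rho> t) \<omega> \<partial>\<rho> t\<bar> \<le> grad_bound * Phi_grad_bound"
      by (simp add: \<mu>.prob_space)
    then have "\<bar>- 2 * \<zeta> t\<bar> * \<bar>\<integral>\<omega>. logit_grad i (X, \<omega>) \<bullet> Phi_grad (\<rho> t) \<omega> \<partial>\<rho> t\<bar>
        \<le> (2 * Z) * (grad_bound * Phi_grad_bound)"
      using Z[OF \<open>0 \<le> t\<close>] by (intro mult_mono) auto
    then show ?thesis
      by (simp add: velocity_def abs_mult)
  qed
  then show ?thesis by (rule that)
qed

lemma measurable_inner_Phi_grad: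
  assumes "0 \<le> t"
  shows "(\<lambda>z. logit_grad i (fst z, snd z) \<bullet> Phi_grad (\<rho> t) (snd z)) \<in> borel_measurable (D \<Otimes>\<^sub>M \<rho> t)"
proof -
  note \<mu> = \<rho>_in[OF assms]
  have [measurable]: "Phi_grad (\<rho> t) \<in> borel_measurable (\<rho> t)"
    by (rule borel_measurable_prob_measures[OF \<mu> continuous_Phi_grad[OF \<mu>]])
  have [measurable]: "(\<lambda>z. logit_grad i (fst z, snd z)) \<in> borel_measurable (D \<Otimes>\<^sub>M \<rho> t)"
    by (rule borel_measurable_pair_prob_measures[OF \<mu> sets_D continuous_logit_grad])
  show ?thesis by measurable
qed

lemma measurable_velocity:
  assumes "0 \<le> t"
  shows "(\<lambda>X. velocity i X t) \<in> borel_measurable D"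
proof -
  have "(\<lambda>X. \<integral>\<omega>. logit_grad i (X, \<omega>) \<bullet> Phi_grad (\<rho> t) \<omega> \<partial>\<rho> t) \<in> borel_measurable D"
    using borel_measurable_integral_prob_measures[OF \<rho>_in[OF assms],
        of "\<lambda>z. logit_grad i z \<bullet> Phi_grad (\<rho> t) (snd z)"] measurable_inner_Phi_grad[OF assms]
    by simp
  then show ?thesis
    unfolding velocity_def by measurable
qed

lemma integrable_loss:
  assumes "0 \<le> t"
  shows "integrable D (\<lambda>X. loss X t)"
proof -
  note \<mu> = \<rho>_in[OF assms]
  interpret \<mu>: prob_space "\<rho> t" using \<mu> by (rule prob_measuresD)
  note [measurable] = measurable_mean_output[OF \<mu>]
  obtain B where B: "0 \<le> B" "\<And>i X w. X \<in> C \<Longrightarrow> w \<in> K \<Longrightarrow> norm (logit i (X, w)) \<le> B"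
    using bounded_on_compact_Times[of logit, OF continuous_logit compact_C compact_K] by blast
  have z: "\<bar>mean_output Wout (\<rho> t) l X $ j\<bar> \<le> B" if "X \<in> C" for l X j
  proof -
    have "\<bar>\<integral>\<omega>. logit (l, j) (X, \<omega>) \<partial>\<rho> t\<bar> \<le> (\<integral>\<omega>. \<bar>logit (l, j) (X, \<omega>)\<bar> \<partial>\<rho> t)"
      by (rule integral_abs_bound)
    also have "\<dots> \<le> (\<integral>\<omega>. B \<partial>\<rho> t)"
      using integrable_prob_measures[OF \<mu> compact_K continuous_logit_snd] B(2)[OF that]
      by (intro integral_mono) (auto simp: prob_measuresD(3)[OF \<mu>] simp flip: real_norm_def)
    finally show ?thesis
      by (simp add: mean_output_nth[OF \<mu>] \<mu>.prob_space)
  qed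
  \<comment> \<open>A single summand, at least \<open>exp (- B)\<close>, bounds the sum from below,
    and all \<open>CARD('v)\<close> summands, each at most \<open>exp B\<close>, bound it from
    above.\<close>
  have ln_bound: "\<bar>ln (\<Sum>j\<in>UNIV. exp (mean_output Wout (\<rho> t) l X $ j))\<bar> \<le> B + ln (real CARD('v))"
    if "X \<in> C" for l X
  proof -
    let ?s = "\<Sum>j\<in>UNIV. exp (mean_output Wout (\<rho> t) l X $ j)"
    have "exp (- B) \<le> exp (mean_output Wout (\<rho> t) l X $ j)" for j
      using z[OF that, of l j] by simp
    moreover have "exp (mean_output Wout (\<rho> t) l X $ j) \<le> ?s" for j
      by (rule member_le_sum) auto
    ultimately have lo: "exp (- B) \<le> ?s"
      using order_trans by blast
    have "?s \<le> (\<Sum>j\<in>(UNIV :: 'v set). exp B)"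
      using z[OF that, of l] by (intro sum_mono) (simp add: abs_le_iff)
    then have hi: "?s \<le> real CARD('v) * exp B"
      by simp
    have "0 < ?s"
      by (intro sum_pos) auto
    then have "ln (exp (- B)) \<le> ln ?s" "ln ?s \<le> ln (real CARD('v) * exp B)"
      using lo hi by (auto intro!: ln_mono simp del: ln_exp)
    moreover have "ln (real CARD('v) * exp B) = ln (real CARD('v)) + B"
      by (simp add: ln_mult)
    moreover have "0 \<le> ln (real CARD('v))"
      by simp
    ultimately show ?thesis
      by (simp only: ln_exp)
  qed
  have "integrable D (\<lambda>X. ln (\<Sum>j\<in>UNIV. exp (mean_output Wout (\<rho> t) l X $ j)))" for l
    using AE_C ln_bound
    by (intro D.integrable_const_bound[of _ "B + ln (real CARD('v))"]) auto
  moreover have "integrable D (\<lambda>X. Y l X $ j * mean_output Wout (\<rho> t) l X $ j)" for l j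
  proof (rule D.integrable_const_bound[of _ "1 * B"])
    show "AE X in D. norm (Y l X $ j * mean_output Wout (\<rho> t) l X $ j) \<le> 1 * B"
      using AE_admissible
    proof eventually_elim
      case (elim X)
      have "\<bar>Y l X $ j\<bar> \<le> 1"
        using elim by (auto simp: admissible_def one_hot_def axis_def dest!: spec[of _ l])
      then show ?case
        unfolding real_norm_def abs_mult using elim z[of X l j]
        by (intro mult_mono) (auto simp: admissible_def)
    qed
  qed measurable
  ultimately show ?thesis
    unfolding loss_def cross_entropy_def inner_vec_def by simp
qed

text \<open>By Fubini, the chain rule term is the squared norm of the gradient of the first variation.\<close>

lemma expected_loss_rate:
  assumes "0 \<le> t"
  shows "(\<integral>X. (\<Sum>i\<in>UNIV. residual (\<rho> t) i X * velocity i X t) \<partial>D)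
    = - 2 * \<zeta> t * dissipation Wout D Y (\<rho> t)"
proof -
  note \<mu> = \<rho>_in[OF assms]
  interpret \<mu>: prob_space "\<rho> t" using \<mu> by (rule prob_measuresD)
  interpret P: pair_sigma_finite D "\<rho> t" ..
  \<comment> \<open>Integrated over \<open>X\<close> this becomes the squared norm of
    \<open>Phi_grad\<close> at \<open>\<omega>\<close>, as \<open>Phi_grad\<close> is the
    expectation of the weighted gradient; integrated over \<open>\<omega>\<close> it becomes the
    chain rule sum up to the factor \<open>- 2 * \<zeta> t\<close>.\<close>
  let ?F = "\<lambda>X \<omega>. (\<Sum>i\<in>UNIV. residual (\<rho> t) i X *\<^sub>R logit_grad i (X, \<omega>)) \<bullet> Phi_grad (\<rho> t) \<omega>"
  have eq: "?F X \<omega> = (\<Sum>i\<in>UNIV. residual (\<rho> t) i X * (logit_grad i (X, \<omega>) \<bullet> Phi_grad (\<rho> t) \<omega>))" for X \<omega>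
    by (simp add: inner_sum_left)
  have int: "integrable (\<rho> t) (\<lambda>\<omega>. logit_grad i (X, \<omega>) \<bullet> Phi_grad (\<rho> t) \<omega>)" for i X
    by (intro integrable_prob_measures[OF \<mu> compact_K] continuous_intros continuous_logit_grad_snd
        continuous_Phi_grad \<mu>)
  have intF: "integrable (\<rho> t) (?F X)" for X
    unfolding eq by (intro Bochner_Integration.integrable_sum integrable_mult_right int)
  have meas: "case_prod ?F \<in> borel_measurable (D \<Otimes>\<^sub>M \<rho> t)"
  proof -
    note [measurable] = measurable_residual[OF \<mu>]
    have [measurable]: "(\<lambda>z. logit_grad i (fst z, snd z) \<bullet> Phi_grad (\<rho> t) (snd z)) \<in> borel_measurable (D \<Otimes>\<^sub>M \<rho> t)" for i
      by (rule measurable_inner_Phi_grad[OF assms])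
    show ?thesis
      unfolding eq case_prod_beta by measurable
  qed
  have bound: "norm (?F X \<omega>) \<le> Phi_grad_bound * Phi_grad_bound" if "admissible X" "\<omega> \<in> K" for X \<omega>
  proof -
    have "norm (?F X \<omega>) \<le> norm (\<Sum>i\<in>UNIV. residual (\<rho> t) i X *\<^sub>R logit_grad i (X, \<omega>)) * norm (Phi_grad (\<rho> t) \<omega>)"
      unfolding real_norm_def by (rule Cauchy_Schwarz_ineq2)
    also have "\<dots> \<le> Phi_grad_bound * Phi_grad_bound"
      using norm_weighted_grad_le[OF that] norm_Phi_grad_le[OF \<mu> that(2)]
        order_trans[OF norm_ge_zero norm_Phi_grad_le[OF \<mu> that(2)]]
      unfolding Phi_grad_bound_def by (intro mult_mono) auto
    finally show ?thesis .
  qed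
  have "integrable (D \<Otimes>\<^sub>M \<rho> t) (case_prod ?F)"
  proof (rule P.Fubini_integrable[OF meas])
    show "integrable D (\<lambda>X. \<integral>\<omega>. norm (case_prod ?F (X, \<omega>)) \<partial>\<rho> t)"
    proof (rule D.integrable_const_bound)
      show "(\<lambda>X. \<integral>\<omega>. norm (case_prod ?F (X, \<omega>)) \<partial>\<rho> t) \<in> borel_measurable D"
        using meas by measurable
      show "AE X in D. norm (\<integral>\<omega>. norm (case_prod ?F (X, \<omega>)) \<partial>\<rho> t) \<le> Phi_grad_bound * Phi_grad_bound"
        using AE_admissible
      proof eventually_elim
        case (elim X)
        have "(\<integral>\<omega>. norm (?F X \<omega>) \<partial>\<rho> t) \<le> (\<integral>\<omega>. Phi_grad_bound * Phi_grad_bound \<partial>\<rho> t)"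
        proof (rule integral_mono)
          fix \<omega> assume "\<omega> \<in> space (\<rho> t)"
          then show "norm (?F X \<omega>) \<le> Phi_grad_bound * Phi_grad_bound"
            using bound[OF elim] prob_measuresD(3)[OF \<mu>] by blast
        qed (use intF in simp_all)
        moreover have "0 \<le> (\<integral>\<omega>. norm (?F X \<omega>) \<partial>\<rho> t)"
          by simp
        ultimately show ?case
          by (simp add: \<mu>.prob_space)
      qed
    qed
    show "AE X in D. integrable (\<rho> t) (\<lambda>\<omega>. case_prod ?F (X, \<omega>))"
      using intF by simp
  qed
  then have "(\<integral>\<omega>. (\<integral>X. ?F X \<omega> \<partial>D) \<partial>\<rho> t) = (\<integral>X. (\<integral>\<omega>. ?F X \<omega> \<partial>\<rho> t) \<partial>D)"
    by (rule P.Fubini_integral)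
  moreover have "(\<integral>X. ?F X \<omega> \<partial>D) = (norm (Phi_grad (\<rho> t) \<omega>))\<^sup>2" if "\<omega> \<in> K" for \<omega>
    using integral_inner_left[OF integrable_weighted_grad[OF \<mu> that], of "Phi_grad (\<rho> t) \<omega>"]
    by (simp add: Phi_grad_def power2_norm_eq_inner)
  then have "(\<integral>\<omega>. (\<integral>X. ?F X \<omega> \<partial>D) \<partial>\<rho> t) = dissipation Wout D Y (\<rho> t)"
    unfolding dissipation_def grad_Phi[OF \<mu>]
    by (intro Bochner_Integration.integral_cong) (auto simp: prob_measuresD(3)[OF \<mu>])
  moreover have "(\<Sum>i\<in>UNIV. residual (\<rho> t) i X * velocity i X t) = - 2 * \<zeta> t * (\<integral>\<omega>. ?F X \<omega> \<partial>\<rho> t)" for X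
  proof -
    have "(\<integral>\<omega>. ?F X \<omega> \<partial>\<rho> t) = (\<Sum>i\<in>UNIV. residual (\<rho> t) i X * (\<integral>\<omega>. logit_grad i (X, \<omega>) \<bullet> Phi_grad (\<rho> t) \<omega> \<partial>\<rho> t))"
      unfolding eq by (simp add: int)
    then show ?thesis
      unfolding velocity_def by (simp add: sum_distrib_left mult_ac)
  qed
  ultimately show ?thesis
    by simp
qed

text \<open>Taking the half-line as the convex set includes the one-sided derivative at time 0. The
  dominating constant has one term \<open>2 * B\<close> per logit: 2 from the residual and
  \<open>B\<close> from the velocity.\<close>

theorem risk_has_derivative:
  assumes "0 \<le> t"
  shows "((\<lambda>t. risk Wout D Y (\<rho> t)) has_real_derivative - 2 * \<zeta> t * dissipation Wout D Y (\<rho> t))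
    (at t within {0..})"
proof -
  obtain B where B: "\<And>i X t. 0 \<le> t \<Longrightarrow> X \<in> C \<Longrightarrow> \<bar>velocity i X t\<bar> \<le> B"
    using velocity_bounded by blast
  have "((\<lambda>t. \<integral>X. loss X t \<partial>D) has_derivative
      (\<lambda>h. h \<bullet> (\<integral>X. (\<Sum>i\<in>UNIV. residual (\<rho> t) i X * velocity i X t) \<partial>D))) (at t within {0..})"
  proof (rule has_derivative_integral[where B = "\<Sum>i\<in>(UNIV :: ('l \<times> 'v) set). 2 * B"])
    show "(\<lambda>X. \<Sum>i\<in>UNIV. residual (\<rho> t) i X * velocity i X t) \<in> borel_measurable D"
      using measurable_residual[OF \<rho>_in[OF assms]] measurable_velocity[OF assms] by measurable
    show "AE X in D. \<forall>s\<in>{0..}.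
       (loss X has_derivative (\<lambda>h. h \<bullet> (\<Sum>i\<in>UNIV. residual (\<rho> s) i X * velocity i X s))) (at s within {0..}) \<and>
       norm (\<Sum>i\<in>UNIV. residual (\<rho> s) i X * velocity i X s) \<le> (\<Sum>i\<in>(UNIV :: ('l \<times> 'v) set). 2 * B)"
      using AE_admissible
    proof eventually_elim
      case (elim X)
      show ?case
      proof (intro ballI conjI)
        fix s :: real assume "s \<in> {0..}"
        then have s: "0 \<le> s" by simp
        show "(loss X has_derivative (\<lambda>h. h \<bullet> (\<Sum>i\<in>UNIV. residual (\<rho> s) i X * velocity i X s))) (at s within {0..})"
          using loss_has_derivative[OF s] by (simp add: has_field_derivative_def mult_commute_abs)
        show "norm (\<Sum>i\<in>UNIV. residual (\<rho> s) i X * velocity i X s) \<le> (\<Sum>i\<in>(UNIV :: ('l \<times> 'v) set). 2 * B)"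
        proof (rule sum_norm_le)
          show "norm (residual (\<rho> s) i X * velocity i X s) \<le> 2 * B" for i
            unfolding real_norm_def abs_mult
            using residual_bound[OF elim] B[OF s] elim by (intro mult_mono) (auto simp: admissible_def)
        qed
      qed
    qed
  qed (use assms integrable_loss D.finite_measure_axioms in auto)
  moreover have "(\<integral>X. loss X s \<partial>D) = risk Wout D Y (\<rho> s)" for s
    by (simp add: risk_def loss_def)
  ultimately show ?thesis
    unfolding expected_loss_rate[OF assms] has_field_derivative_def
    by (simp only: inner_real_def mult_commute_abs)
qed

end

text \<open>The Lojasiewicz hypothesis is imposed where the excess risk is nonnegative, since a
  fractional power of a negative number has no meaning. In HOL \<open>0 powr a = 0\<close>, whereas
  the second bound intends 0 to a negative exponent to be infinite, which turns its right-hand side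
  into 0; the last conjunct records that case.\<close>

theorem theorem6p10:
  fixes Wout :: "('x::finite, 'v::finite) matrix"
    and D :: "('l::{finite,linorder}, 'x) matrix measure"
    and Y :: "'l \<Rightarrow> ('l, 'x) matrix \<Rightarrow> real ^ 'v"
    and \<zeta> :: "real \<Rightarrow> real"
    and K :: "('x, 'k::finite) head set"
    and Kx :: "(real ^ 'x) set"
    and \<rho>bar :: "('x, 'k) head measure"
    and \<rho> :: "real \<Rightarrow> ('x, 'k) head measure"
    and \<U> :: "('x, 'k) head measure set"
    and c_KL \<theta> t0 :: real
    and G :: "real \<Rightarrow> real"
  assumes "data_model D Y"
    and "learning_rate \<zeta>"
    and "smoothness_assumption Wout D K Kx"
    and "stationary_solution Wout D Y \<zeta> K \<rho>bar"
    and "\<U> \<subseteq> prob_measures K"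
    and "\<exists>W. openin (narrow_topology K) W \<and> \<rho>bar \<in> W \<and> W \<subseteq> \<U>"
    and "0 < c_KL"
    and "1 / 2 \<le> \<theta>" and "\<theta> < 1"
    and "\<And>\<mu>. \<mu> \<in> \<U> \<Longrightarrow> risk Wout D Y \<rho>bar \<le> risk Wout D Y \<mu> \<Longrightarrow>
           sqrt (dissipation Wout D Y \<mu>) \<ge> c_KL * (risk Wout D Y \<mu> - risk Wout D Y \<rho>bar) powr \<theta>"
    and "weak_solution Wout D Y \<zeta> K \<rho>"
    and "0 \<le> t0"
    and "\<And>t. t0 \<le> t \<Longrightarrow> \<rho> t \<in> \<U>"
    and "\<And>t. G t = risk Wout D Y (\<rho> t) - risk Wout D Y \<rho>bar"
  shows "\<forall>t\<ge>t0.
     (\<theta> = 1 / 2 \<longrightarrow>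
        G t \<le> G t0 * exp (- 2 * c_KL\<^sup>2 * integral {t0..t} \<zeta>)) \<and>
     (1 / 2 < \<theta> \<longrightarrow>
        G t \<le> (G t0 powr (1 - 2 * \<theta>) + 2 * c_KL\<^sup>2 * (2 * \<theta> - 1) * integral {t0..t} \<zeta>)
                 powr (- 1 / (2 * \<theta> - 1)) \<and>
        (G t0 = 0 \<longrightarrow> G t \<le> 0))"
proof -
  obtain M where M: "\<And>x. x \<in> Kx \<Longrightarrow> norm x \<le> M"
    using assms(3) compact_imp_bounded[of Kx] unfolding smoothness_assumption_def bounded_iff
    by meson
  \<comment> \<open>The norm of a matrix is at most the sum of the norms of its rows, and each row
    lies in \<open>Kx\<close>.\<close>
  define C :: "('l, 'x) matrix set" where "C = cball 0 (\<Sum>l\<in>(UNIV :: 'l set). M)"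
  have "X \<in> C" if "\<forall>l. X $ l \<in> Kx" for X
  proof -
    have "norm X \<le> (\<Sum>l\<in>UNIV. norm (X $ l))"
      unfolding norm_vec_def by (rule L2_set_le_sum) simp
    also have "\<dots> \<le> (\<Sum>l\<in>(UNIV :: 'l set). M)"
      using M that by (intro sum_mono) auto
    finally show ?thesis by (simp add: C_def)
  qed
  then have AE: "AE X in D. X \<in> C"
    using assms(3) by (auto simp: smoothness_assumption_def elim!: eventually_mono)
  have \<zeta>: "continuous_on {0..} \<zeta>" "bounded (\<zeta> ` {0..})" "\<And>t. 0 \<le> t \<Longrightarrow> 0 \<le> \<zeta> t"
    using assms(2) by (auto simp: learning_rate_def intro: lipschitz_on_continuous_on)
  interpret attention_flow Wout D Y \<zeta> K C \<rho>
    by unfold_locales (use assms(1,3,11) AE \<zeta> in \<open>auto simp: smoothness_assumption_def C_def\<close>)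
  have DG: "(G has_real_derivative - 2 * \<zeta> t * dissipation Wout D Y (\<rho> t)) (at t within {t0..})"
    if "t0 \<le> t" for t
  proof -
    have "(G has_real_derivative - 2 * \<zeta> t * dissipation Wout D Y (\<rho> t)) (at t within {0..})"
      using risk_has_derivative[of t] that \<open>0 \<le> t0\<close>
      unfolding assms(14)[abs_def] by (auto intro!: derivative_eq_intros)
    then show ?thesis
      by (rule DERIV_subset) (use \<open>0 \<le> t0\<close> in auto)
  qed
  have \<zeta>': "continuous_on {t0..} \<zeta>" "\<And>t. t0 \<le> t \<Longrightarrow> 0 \<le> \<zeta> t"
    using continuous_on_subset[OF \<zeta>(1)] \<zeta>(3) \<open>0 \<le> t0\<close> by auto
  have dis: "0 \<le> dissipation Wout D Y (\<rho> t)" for t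
    by (simp add: dissipation_def)
  have KL: "c_KL * G t powr \<theta> \<le> sqrt (dissipation Wout D Y (\<rho> t))" if "t0 \<le> t" "0 \<le> G t" for t
    using assms(10)[OF assms(13)[OF that(1)]] that(2) unfolding assms(14) by simp
  note hyps = \<zeta>' DG dis KL assms(7-9)
  show ?thesis
  proof (intro allI impI conjI)
    fix t assume t: "t0 \<le> t"
    show "G t \<le> G t0 * exp (- 2 * c_KL\<^sup>2 * integral {t0..t} \<zeta>)" if "\<theta> = 1 / 2"
      by (rule KL_decay(1)[of t0 \<zeta> G "\<lambda>t. dissipation Wout D Y (\<rho> t)" c_KL \<theta> t]) (assumption | rule hyps t that)+
    show "G t \<le> (G t0 powr (1 - 2 * \<theta>) + 2 * c_KL\<^sup>2 * (2 * \<theta> - 1) * integral {t0..t} \<zeta>)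
        powr (- 1 / (2 * \<theta> - 1))" if "1 / 2 < \<theta>"
      by (rule KL_decay(2)[of t0 \<zeta> G "\<lambda>t. dissipation Wout D Y (\<rho> t)" c_KL \<theta> t]) (assumption | rule hyps t that)+
    have "G t \<le> G t0"
      by (rule KL_decay(3)[of t0 \<zeta> G "\<lambda>t. dissipation Wout D Y (\<rho> t)" c_KL \<theta> t]) (assumption | rule hyps t)+
    then show "G t \<le> 0" if "G t0 = 0"
      using that by simp
  qed
qed

end
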